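(* Let $I,J,K,H,H_0$ be positive integers with $H_0\le H$. Consider the statistical model on $x\in\mathbb{R}^{I\times J\times K}$ $$p(x\mid A,B,C)=\frac{1}{(2\pi)^{IJK/2}}\exp\Big(-\tfrac12\|x-A\circ B\circ C\|^2\Big),\qquad A\in\mathbb{R}^{I\times H},\ B\in\mathbb{R}^{J\times H},\ C\in\mathbb{R}^{K\times H}.$$ Assume the data-generating density is $q(x)=p(x\mid A_0,B_0,C_0)$ for some $A_0\in\mathbb{R}^{I\times H_0}$, $B_0\in\mathbb{R}^{J\times H_0}$, $C_0\in\mathbb{R}^{K\times H_0}$ (the $H_0$-term tensor $A_0\circ B_0\circ C_0$ being realized in the $H$-term model by padding with zero columns). Let the prior $\phi(A,B,C)$ be bounded by a $C^\infty$ function whose (compact) support contains this true parameter. Let $K(w)=\int q(x)\log\frac{q(x)}{p(x\mid w)}\,dx$ for $w=(A,B,C)$. Then the real log canonical threshold $\lambda=\lambda(K,\phi)$ satisfies $$\lambda\le \frac{H_0(I+J+K)-2}{2}+\min\{m_1,m_2,m_3\},$$ where $m_1=F(IJ,K,H-H_0)$, $m_2=F(JK,I,H-H_0)$, $m_3=F(KI,J,H-H_0)$.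
   Context: For $A\in\mathbb{R}^{I\times H}$, $B\in\mathbb{R}^{J\times H}$, $C\in\mathbb{R}^{K\times H}$, $A\circ B\circ C$ denotes the $I\times J\times K$ tensor with entries $(A\circ B\circ C)_{ijk}=\sum_{h=1}^H A_{ih}B_{jh}C_{kh}$; $\|\cdot\|^2$ is the sum of squares of all entries (squared Frobenius norm). Real log canonical threshold (RLCT): for a nonnegative analytic function $K(w)$ on $\mathbb{R}^d$ and a nonnegative function $\phi(w)$ (bounded by a $C^\infty$ function with compact support), the zeta function $\zeta(z)=\int K(w)^z\phi(w)\,dw$, holomorphic for $\Re z>0$, extends to a meromorphic function on $\mathbb{C}$ whose poles are real and negative; if $-\lambda$ is its largest pole, $\lambda=\lambda(K,\phi)$ is the RLCT of $(K,\phi)$. For nonnegative integers $N,M,H$, define $F(N,M,H)=\frac{2(NM+MH+HN)-(N^2+M^2+H^2)}{8}$ if $|N-M|\le H\le N+M$ and $H+M-N$ is even; $F(N,M,H)=\frac{2(NM+MH+HN)-(N^2+M^2+H^2)+1}{8}$ if $|N-M|\le H\le N+M$ and $H+M-N$ is odd; $F(N,M,H)=\frac{MH}{2}$ if $H\le N-M$; $F(N,M,H)=\frac{NH}{2}$ if $H\le M-N$; $F(N,M,H)=\frac{NM}{2}$ if $M+N\le H$.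
   Formalization: The prior φ is additionally assumed measurable and bounded below by a positive constant on a neighbourhood of the true parameter; without this the bound fails (e.g. φ = K^m times a bump function raises λ by m). *)

theory Defs
  imports "HOL-Analysis.Analysis" "HOL-Complex_Analysis.Complex_Analysis"
begin

definition Ffun :: "nat \<Rightarrow> nat \<Rightarrow> nat \<Rightarrow> real" where
  "Ffun N M H =
    (let n = int N; m = int M; h = int H in
     if \<bar>n - m\<bar> \<le> h \<and> h \<le> n + m then
       (if even (h + m - n)
        then real_of_int (2 * (n * m + m * h + h * n) - (n^2 + m^2 + h^2)) / 8
        else real_of_int (2 * (n * m + m * h + h * n) - (n^2 + m^2 + h^2) + 1) / 8)
     else if h \<le> n - m then real_of_int (m * h) / 2
     else if h \<le> m - n then real_of_int (n * h) / 2
     else real_of_int (n * m) / 2)"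

definition cp_tensor :: "real^'h^'i \<Rightarrow> real^'h^'j \<Rightarrow> real^'h^'k \<Rightarrow> real^'k^'j^'i" where
  "cp_tensor A B C = (\<chi> i j k. \<Sum>h\<in>UNIV. A$i$h * B$j$h * C$k$h)"

definition frob2 :: "real^'k^'j^'i \<Rightarrow> real" where
  "frob2 x = (\<Sum>i\<in>UNIV. \<Sum>j\<in>UNIV. \<Sum>k\<in>UNIV. (x$i$j$k)^2)"

definition tensor_density ::
  "real^'k^'j^'i \<Rightarrow> real^'h^'i \<Rightarrow> real^'h^'j \<Rightarrow> real^'h^'k \<Rightarrow> real" where
  "tensor_density x A B C =
     1 / (2 * pi) powr (real (CARD('i) * CARD('j) * CARD('k)) / 2)
       * exp (- frob2 (x - cp_tensor A B C) / 2)"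

definition KL_tensor ::
  "((real^'h::finite^'i::finite) \<times> (real^'h^'j::finite) \<times> (real^'h^'k::finite)) \<Rightarrow> ((real^'h^'i) \<times> (real^'h^'j) \<times> (real^'h^'k)) \<Rightarrow> real" where
  "KL_tensor w0 w =
     (\<integral>x. tensor_density x (fst w0) (fst (snd w0)) (snd (snd w0)) *
            ln (tensor_density x (fst w0) (fst (snd w0)) (snd (snd w0)) /
                tensor_density x (fst w) (fst (snd w)) (snd (snd w))) \<partial>lborel)"

fun Ck_fun :: "nat \<Rightarrow> ('a::euclidean_space \<Rightarrow> real) \<Rightarrow> bool" where
  "Ck_fun 0 f = continuous_on UNIV f"
| "Ck_fun (Suc n) f = ((\<forall>x. f differentiable (at x)) \<and>
      (\<forall>v. Ck_fun n (\<lambda>x. frechet_derivative f (at x) v)))"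

definition smooth_fun :: "('a::euclidean_space \<Rightarrow> real) \<Rightarrow> bool" where
  "smooth_fun f \<longleftrightarrow> (\<forall>n. Ck_fun n f)"

definition tsupport :: "('a::euclidean_space \<Rightarrow> real) \<Rightarrow> 'a set" where
  "tsupport f = closure {x. f x \<noteq> 0}"

definition zeta_fun :: "('a::euclidean_space \<Rightarrow> real) \<Rightarrow> ('a \<Rightarrow> real) \<Rightarrow> complex \<Rightarrow> complex" where
  "zeta_fun K \<phi> z = (\<integral>w. (complex_of_real (K w)) powr z * complex_of_real (\<phi> w) \<partial>lborel)"

definition is_rlct :: "('a::euclidean_space \<Rightarrow> real) \<Rightarrow> ('a \<Rightarrow> real) \<Rightarrow> real \<Rightarrow> bool" where
  "is_rlct K \<phi> lam \<longleftrightarrow>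
     (\<exists>f. f meromorphic_on UNIV \<and> (\<forall>z. Re z > 0 \<longrightarrow> f z = zeta_fun K \<phi> z) \<and>
          is_pole f (complex_of_real (- lam)) \<and>
          (\<forall>p. is_pole f p \<longrightarrow> Re p \<le> - lam))"

end

theory Submission
  imports Defs "HOL-Probability.Distributions"
begin

text \<open>
  Up to a positive factor, \<open>K\<close> is the squared distance of the tensor of \<open>w\<close> from the true tensor.
  By Landau's theorem on Laplace transforms of positive measures, \<open>\<integral> K\<^sup>-\<^sup>s \<phi>\<close> is finite for
  every \<open>s\<close> below the largest pole, so a volume bound
  \<open>vol {K \<le> \<epsilon>\<^sup>2} \<ge> c \<epsilon>\<^sup>n\<close> near the true parameter forces \<open>\<lambda> \<le> n / 2\<close>.

  The volume is bounded below by imposing linear conditions in stages, each stage depending on the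
  variables fixed before it. In the columns of the true parameter all entries are kept
  \<open>\<epsilon>\<close>-close to the truth, except that the scaling symmetry frees two entries of one column. Of the
  other columns of \<open>A\<close> and \<open>B\<close>, \<open>r\<close> are arbitrary; the rank-one matrices \<open>a\<^sub>h \<otimes> b\<^sub>h\<close> of the
  remaining ones are pushed to within \<open>\<epsilon>\<close> of an \<open>r\<close>-dimensional space containing the first \<open>r\<close>,
  which is a system of \<open>IJ - r\<close> linear equations for \<open>b\<^sub>h\<close>. Then \<open>r\<close> linear equations on each row of
  \<open>C\<close> make the tensor small. Optimising \<open>(IJ - r)(H - H\<^sub>0 - r) + rK\<close> over \<open>r\<close> gives \<open>2F\<close>.
\<close>

section \<open>Volumes of slabs and fibres\<close>

text \<open>The space of dimension \<open>r\<close> is selected afresh for each value of the earlier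
  variables, by a basis construction with no regularity. The iterated bounds therefore never
  integrate over the chosen conditions: each stage bounds from below the fibre volume of a fixed
  Borel set, and the set of points with a large fibre is again Borel, however the conditions were
  found. The choice matters only pointwise.

  The columns may be degenerate, so the conditions can be linearly dependent or zero. The slab bound
  depends only on their number and on a bound for their norms, not on independence; this makes the
  constants uniform in the earlier variables.

  The construction favours one of the three factors, whose size stands alone in \<open>Ffun\<close>.
  To get all three values from one argument, the factors are given as families of basis vectors of a
  single Euclidean space, and their roles are permuted cyclically.\<close>

lemma translate_in_borel:
  fixes A :: "'a::euclidean_space set"
  assumes [measurable]: "A \<in> sets borel"
  shows "{x. x + c \<in> A} \<in> sets borel"
  by measurable

lemma emeasure_lborel_translate:
  fixes A :: "'a::euclidean_space set"
  assumes "A \<in> sets borel"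
  shows "emeasure lborel {x. x + c \<in> A} = emeasure lborel A"
proof -
  have "emeasure lborel A = emeasure (distr lborel borel ((+) c)) A"
    by (simp only: lborel_distr_plus)
  also have "\<dots> = emeasure lborel ((+) c -` A \<inter> space lborel)"
    using assms by (intro emeasure_distr) auto
  also have "(+) c -` A \<inter> space lborel = {x. x + c \<in> A}"
    by (auto simp: add.commute)
  finally show ?thesis ..
qed

lemma nn_integral_lborel_translate:
  fixes f :: "'a::euclidean_space \<Rightarrow> ennreal"
  assumes [measurable]: "f \<in> borel_measurable borel"
  shows "(\<integral>\<^sup>+x. f (x + c) \<partial>lborel) = (\<integral>\<^sup>+x. f x \<partial>lborel)"
proof -
  have "(\<integral>\<^sup>+x. f x \<partial>lborel) = (\<integral>\<^sup>+x. f x \<partial>distr lborel borel ((+) c))"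
    by (simp add: lborel_distr_plus)
  also have "\<dots> = (\<integral>\<^sup>+x. f (x + c) \<partial>lborel)"
    by (subst nn_integral_distr) (auto simp: add.commute)
  finally show ?thesis ..
qed

lemma emeasure_lborel_ball_eq:
  "emeasure lborel (ball c r) = ennreal (measure lborel (ball (c::'a::euclidean_space) r))"
  using emeasure_lborel_ball_finite[of c r] by (intro emeasure_eq_ennreal_measure) simp

lemma slab_measurable [measurable]:
  fixes V :: "'a::euclidean_space set"
  assumes "finite V"
  shows "{x\<in>ball 0 \<rho>. \<forall>v\<in>V. \<bar>x \<bullet> v\<bar> < \<epsilon>} \<in> sets borel"
proof -
  have "{x\<in>ball 0 \<rho>. \<forall>v\<in>V. \<bar>x \<bullet> v\<bar> < \<epsilon>} = ball 0 \<rho> \<inter> (\<Inter>v\<in>V. {x. \<bar>x \<bullet> v\<bar> < \<epsilon>})"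
    by auto
  also have "open \<dots>"
    using assms by (intro open_Int open_INT ballI open_Collect_less continuous_intros) auto
  finally show ?thesis by simp
qed

text \<open>Pigeonhole: the level cells of the functionals cover the half-size ball, and each cell
  lies in a translate of the slab.\<close>
lemma slab_volume:
  fixes V :: "'a::euclidean_space set"
  assumes V: "finite V" "card V \<le> m" "\<And>v. v \<in> V \<Longrightarrow> norm v \<le> \<Lambda>"
    and \<rho>: "0 < \<rho>" and \<Lambda>: "0 \<le> \<Lambda>" and \<epsilon>: "0 < \<epsilon>" "\<epsilon> \<le> 1"
  shows "ennreal (measure lborel (ball (0::'a) (\<rho>/2)) / (\<Lambda> * \<rho> + 2) ^ m * \<epsilon> ^ m)
           \<le> emeasure lborel {x\<in>ball 0 \<rho>. \<forall>v\<in>V. \<bar>x \<bullet> v\<bar> < \<epsilon>}" (is "_ \<le> emeasure _ ?T")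
proof -
  \<comment> \<open>By Cauchy-Schwarz \<open>t\<close> bounds
    \<open>\<bar>x \<bullet> v / \<epsilon>\<bar>\<close> on the half-size ball, so \<open>Z\<close>
    contains every value that the floors can take.\<close>
  define t where "t = \<Lambda> * \<rho> / (2 * \<epsilon>)"
  define Z where "Z = {\<lfloor>- t\<rfloor>..\<lfloor>t\<rfloor>}"
  define U where "U k = ball (0::'a) (\<rho>/2) \<inter> {x. \<forall>v\<in>V. \<lfloor>x \<bullet> v / \<epsilon>\<rfloor> = k v}" for k
  have t0: "0 \<le> t" using \<rho> \<Lambda> \<epsilon> by (auto simp: t_def)
  have cardZ: "real (card Z) \<le> (\<Lambda> * \<rho> + 2) / \<epsilon>"
  proof -
    have "real (card Z) = real_of_int (\<lfloor>t\<rfloor> + 1 - \<lfloor>-t\<rfloor>)"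
      unfolding Z_def using t0 by (simp add: floor_le_iff) linarith
    also have "\<dots> \<le> 2 * t + 2" by linarith
    also have "2 * t + 2 \<le> (\<Lambda> * \<rho> + 2) / \<epsilon>"
      using \<epsilon> by (simp add: t_def field_simps)
    finally show ?thesis .
  qed
  have Ubor: "U k \<in> sets borel" for k
  proof -
    have eq: "U k = ball (0::'a) (\<rho>/2) \<inter> (\<Inter>v\<in>V. {x. \<lfloor>x \<bullet> v / \<epsilon>\<rfloor> = k v})"
      by (auto simp: U_def)
    have "(\<Inter>v\<in>V. {x. \<lfloor>x \<bullet> v / \<epsilon>\<rfloor> = k v}) \<in> sets borel" using V(1)
    proof (cases "V = {}")
      case False
      then show ?thesis by (intro sets.finite_INT V) measurable
    qed auto
    then show ?thesis unfolding eq by auto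
  qed
  have cover: "ball 0 (\<rho>/2) \<subseteq> (\<Union>k\<in>PiE V (\<lambda>_. Z). U k)"
  proof
    fix x :: 'a assume x: "x \<in> ball 0 (\<rho>/2)"
    let ?k = "restrict (\<lambda>v. \<lfloor>x \<bullet> v / \<epsilon>\<rfloor>) V"
    have "\<lfloor>x \<bullet> v / \<epsilon>\<rfloor> \<in> Z" if v: "v \<in> V" for v
    proof -
      have "\<bar>x \<bullet> v\<bar> \<le> norm x * norm v" by (rule Cauchy_Schwarz_ineq2)
      also have "\<dots> \<le> (\<rho>/2) * \<Lambda>" using x V(3)[OF v] \<rho> by (intro mult_mono) auto
      finally have "\<bar>x \<bullet> v / \<epsilon>\<bar> \<le> t" using \<epsilon> by (simp add: t_def field_simps)
      then have "- t \<le> x \<bullet> v / \<epsilon>" "x \<bullet> v / \<epsilon> \<le> t" by linarith+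
      then show ?thesis by (auto simp: Z_def intro!: floor_mono)
    qed
    then have "?k \<in> PiE V (\<lambda>_. Z)" by auto
    moreover have "x \<in> U ?k" using x by (auto simp: U_def)
    ultimately show "x \<in> (\<Union>k\<in>PiE V (\<lambda>_. Z). U k)" by blast
  qed
  have finP: "finite (PiE V (\<lambda>_. Z))" using V(1) by (intro finite_PiE) (auto simp: Z_def)
  have cell: "emeasure lborel (U k) \<le> emeasure lborel ?T" for k
  proof (cases "U k = {}")
    case False
    then obtain x0 where x0: "x0 \<in> U k" by blast
    have "U k \<subseteq> {x. x + (- x0) \<in> ?T}"
    proof
      fix x assume x: "x \<in> U k"
      have "norm (x - x0) \<le> norm x + norm x0" by (rule norm_triangle_ineq4)
      moreover have "\<bar>(x - x0) \<bullet> v\<bar> < \<epsilon>" if "v \<in> V" for v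
      proof -
        have "\<lfloor>x \<bullet> v / \<epsilon>\<rfloor> = \<lfloor>x0 \<bullet> v / \<epsilon>\<rfloor>" using x x0 that by (auto simp: U_def)
        then have "\<bar>x \<bullet> v / \<epsilon> - x0 \<bullet> v / \<epsilon>\<bar> < 1" by linarith
        moreover have "x \<bullet> v / \<epsilon> - x0 \<bullet> v / \<epsilon> = (x - x0) \<bullet> v / \<epsilon>"
          by (simp add: inner_diff_left diff_divide_distrib)
        ultimately show ?thesis using \<epsilon> by (simp add: abs_divide)
      qed
      ultimately show "x \<in> {x. x + (- x0) \<in> ?T}" using x x0 by (auto simp: U_def)
    qed
    then have "emeasure lborel (U k) \<le> emeasure lborel {x. x + (- x0) \<in> ?T}"
      by (intro emeasure_mono sets_lborel[THEN eqset_imp_iff, THEN iffD2] translate_in_borel slab_measurable V)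
    also have "\<dots> = emeasure lborel ?T"
      by (intro emeasure_lborel_translate slab_measurable V)
    finally show ?thesis .
  qed auto
  have "emeasure lborel ?T \<le> emeasure lborel (ball (0::'a) \<rho>)"
    by (intro emeasure_mono) auto
  also have "\<dots> < top"
    using emeasure_lborel_ball_finite[of "0::'a" \<rho>] by (simp add: less_top)
  finally have Tfin: "emeasure lborel ?T = ennreal (measure lborel ?T)"
    by (intro emeasure_eq_ennreal_measure) auto
  have "emeasure lborel (ball (0::'a) (\<rho>/2)) \<le> (\<Sum>k\<in>PiE V (\<lambda>_. Z). emeasure lborel (U k))"
    using finP Ubor cover
    by (intro order_trans[OF emeasure_mono[OF cover] emeasure_subadditive_finite]) auto
  also have "\<dots> \<le> (\<Sum>k\<in>PiE V (\<lambda>_. Z). emeasure lborel ?T)" by (intro sum_mono cell)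
  also have "\<dots> = of_nat (card Z ^ card V) * emeasure lborel ?T"
    by (simp add: card_PiE V(1))
  also have "\<dots> = ennreal (real (card Z) ^ card V * measure lborel ?T)"
    by (subst Tfin) (simp add: ennreal_mult ennreal_of_nat_eq_real_of_nat del: mem_ball)
  also have "emeasure lborel (ball (0::'a) (\<rho>/2)) = ennreal (measure lborel (ball (0::'a) (\<rho>/2)))"
    by (rule emeasure_lborel_ball_eq)
  finally have *: "measure lborel (ball (0::'a) (\<rho>/2)) \<le> real (card Z) ^ card V * measure lborel ?T"
    by (simp add: ennreal_le_iff)
  have "real (card Z) ^ card V \<le> ((\<Lambda> * \<rho> + 2) / \<epsilon>) ^ card V"
    by (intro power_mono cardZ) auto
  also have "\<dots> \<le> ((\<Lambda> * \<rho> + 2) / \<epsilon>) ^ m"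
  proof (intro power_increasing V)
    have "0 \<le> \<Lambda> * \<rho>" using \<Lambda> \<rho> by simp
    then show "1 \<le> (\<Lambda> * \<rho> + 2) / \<epsilon>" using \<epsilon> by (simp add: field_simps)
  qed
  finally have "measure lborel (ball (0::'a) (\<rho>/2)) \<le> ((\<Lambda> * \<rho> + 2) / \<epsilon>) ^ m * measure lborel ?T"
    using * by (meson measure_nonneg mult_right_mono order_trans)
  moreover have "0 < \<Lambda> * \<rho> + 2" using \<Lambda> \<rho> by (simp add: add_nonneg_pos)
  ultimately have "measure lborel (ball (0::'a) (\<rho>/2)) / (\<Lambda> * \<rho> + 2) ^ m * \<epsilon> ^ m \<le> measure lborel ?T"
    using \<epsilon> by (simp add: power_divide field_simps)
  then have "ennreal (measure lborel (ball (0::'a) (\<rho>/2)) / (\<Lambda> * \<rho> + 2) ^ m * \<epsilon> ^ m) \<le> ennreal (measure lborel ?T)"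
    by (rule ennreal_leI)
  also have "\<dots> = emeasure lborel ?T"
    using Tfin by simp
  finally show ?thesis .
qed

section \<open>Fubini along the range of a linear map\<close>

lemma borel_measurable_indicator_ball_mult:
  fixes f h :: "'b::euclidean_space \<Rightarrow> 'a::euclidean_space"
  assumes "continuous_on UNIV f" "continuous_on UNIV h" "G \<in> sets borel"
  shows "(\<lambda>p. indicator (ball 0 r) (f p) * indicator G (h p) :: ennreal) \<in> borel_measurable borel" (is ?th1)
    and "(\<lambda>p. indicator (ball 0 r) (f p) * indicator G (h p) :: ennreal) \<in> borel_measurable lborel"
proof -
  show ?th1
  proof (rule borel_measurable_times_ennreal)
  show "(\<lambda>p. indicator (ball 0 r) (f p) :: ennreal) \<in> borel_measurable borel"
    using borel_measurable_continuous_onI[OF assms(1)]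
    by (auto intro!: measurable_compose[OF _ borel_measurable_indicator])
  show "(\<lambda>p. indicator G (h p) :: ennreal) \<in> borel_measurable borel"
    using borel_measurable_continuous_onI[OF assms(2)] assms(3)
    by (auto intro!: measurable_compose[OF _ borel_measurable_indicator])
  qed
  then show "(\<lambda>p. indicator (ball 0 r) (f p) * indicator G (h p) :: ennreal) \<in> borel_measurable lborel"
    by simp
qed

lemma linear_measurable:
  fixes Q :: "'a::euclidean_space \<Rightarrow> 'b::euclidean_space"
  assumes "linear Q"
  shows "Q \<in> borel_measurable borel"
  using linear_continuous_on[OF assms[unfolded linear_conv_bounded_linear], of UNIV]
  by (rule borel_measurable_continuous_onI)

lemma fibre_in_borel:
  fixes Q :: "'a::euclidean_space \<Rightarrow> 'a"
  assumes "linear Q" "G \<in> sets borel"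
  shows "{z\<in>ball 0 r. x + Q z \<in> G} \<in> sets borel"
proof -
  have "(\<lambda>z. x + Q z) \<in> borel_measurable borel" using linear_measurable[OF assms(1)] by simp
  then have "(\<lambda>z. x + Q z) -` G \<in> sets borel" by (rule measurable_sets_borel[OF _ assms(2)])
  then have "ball 0 r \<inter> (\<lambda>z. x + Q z) -` G \<in> sets borel" by simp
  also have "ball 0 r \<inter> (\<lambda>z. x + Q z) -` G = {z\<in>ball 0 r. x + Q z \<in> G}" by auto
  finally show ?thesis .
qed

lemma emeasure_fibre:
  fixes Q :: "'a::euclidean_space \<Rightarrow> 'a"
  assumes "linear Q" "G \<in> sets borel"
  shows "emeasure lborel {z\<in>ball 0 r. x + Q z \<in> G}
    = (\<integral>\<^sup>+z. indicator (ball 0 r) z * indicator G (x + Q z) \<partial>lborel)"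
proof -
  have "emeasure lborel {z\<in>ball 0 r. x + Q z \<in> G} = (\<integral>\<^sup>+z. indicator {z\<in>ball 0 r. x + Q z \<in> G} z \<partial>lborel)"
    using fibre_in_borel[OF assms] by simp
  also have "\<dots> = (\<integral>\<^sup>+z. indicator (ball 0 r) z * indicator G (x + Q z) \<partial>lborel)"
    by (intro nn_integral_cong) (auto split: split_indicator)
  finally show ?thesis .
qed

text \<open>For fixed \<open>y\<close> the point \<open>x + Q y\<close> is a translate of
  \<open>x\<close>, so after exchanging the integrals the inner one is the volume of
  \<open>G\<close> for every \<open>y\<close>. This works for every rank of \<open>Q\<close>, hence
  for fibres along any coordinate subspace.\<close>

lemma shear_fubini:
  fixes Q :: "'a::euclidean_space \<Rightarrow> 'a"
  assumes Q: "linear Q" and G: "G \<in> sets borel"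
  shows "(\<integral>\<^sup>+x. emeasure lborel {y\<in>ball 0 r. x + Q y \<in> G} \<partial>lborel)
    = emeasure lborel G * emeasure lborel (ball (0::'a) r)"
proof -
  have contQ: "continuous_on A Q" for A
    using linear_continuous_on[OF Q[unfolded linear_conv_bounded_linear]] .
  have "(\<integral>\<^sup>+x. emeasure lborel {y\<in>ball 0 r. x + Q y \<in> G} \<partial>lborel)
      = (\<integral>\<^sup>+x. \<integral>\<^sup>+y. indicator (ball 0 r) y * indicator G (x + Q y) \<partial>lborel \<partial>lborel)"
    by (simp only: emeasure_fibre[OF Q G])
  also have "\<dots> = (\<integral>\<^sup>+y. \<integral>\<^sup>+x. indicator (ball 0 r) y * indicator G (x + Q y) \<partial>lborel \<partial>lborel)"
    by (intro lborel_pair.Fubini'[symmetric],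
        unfold case_prod_beta lborel_prod,
        intro borel_measurable_indicator_ball_mult G continuous_intros
          continuous_on_compose2[OF contQ[of UNIV]]) auto
  also have "\<dots> = (\<integral>\<^sup>+y. emeasure lborel G * indicator (ball (0::'a) r) y \<partial>lborel)"
  proof (rule nn_integral_cong)
    fix y :: 'a
    have "(\<integral>\<^sup>+x. indicator G (x + Q y) \<partial>lborel) = emeasure lborel G"
      using nn_integral_lborel_translate[of "indicator G" "Q y"] G by simp
    moreover have "(\<integral>\<^sup>+x. indicator (ball 0 r) y * indicator G (x + Q y) \<partial>lborel)
        = indicator (ball 0 r) y * (\<integral>\<^sup>+x. indicator G (x + Q y) \<partial>lborel)"
      using G by (intro nn_integral_cmult) (auto intro: measurable_compose[OF _ borel_measurable_indicator])
    ultimately show "(\<integral>\<^sup>+x. indicator (ball 0 r) y * indicator G (x + Q y) \<partial>lborel)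
        = emeasure lborel G * indicator (ball 0 r) y"
      by (simp add: mult.commute)
  qed
  also have "\<dots> = emeasure lborel G * emeasure lborel (ball (0::'a) r)"
    by (rule nn_integral_cmult_indicator) simp
  finally show ?thesis .
qed

text \<open>Substituting \<open>y = z - x\<close> in \<open>shear_fubini\<close> turns it into a Fubini inequality
  along the range of \<open>Q\<close> that avoids splitting the space into a product.\<close>
lemma fibre_volume:
  fixes Q :: "'a::euclidean_space \<Rightarrow> 'a" and \<delta> :: ennreal
  assumes Q: "linear Q" and G: "G \<in> sets borel" and \<rho>: "0 < \<rho>"
  defines "X \<equiv> {x\<in>ball 0 \<rho>. \<delta> \<le> emeasure lborel {z\<in>ball 0 \<rho>. x - Q x + Q z \<in> G}}"
  shows "X \<in> sets borel"
    "\<delta> * emeasure lborel X \<le> emeasure lborel G * emeasure lborel (ball (0::'a) (2*\<rho>))"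
proof -
  have contQ: "continuous_on A Q" for A
    using linear_continuous_on[OF Q[unfolded linear_conv_bounded_linear]] .
  have gm: "(\<lambda>x. emeasure lborel {z\<in>ball 0 \<rho>. x - Q x + Q z \<in> G}) \<in> borel_measurable borel"
  proof -
    have "(\<lambda>(x, z). indicator (ball 0 \<rho>) z * indicator G (x - Q x + Q z) :: ennreal)
        \<in> borel_measurable (lborel \<Otimes>\<^sub>M lborel)"
      unfolding case_prod_beta lborel_prod
      by (intro borel_measurable_indicator_ball_mult G continuous_intros
          continuous_on_compose2[OF contQ[of UNIV]]) auto
    then have "(\<lambda>x. \<integral>\<^sup>+z. indicator (ball 0 \<rho>) z * indicator G (x - Q x + Q z) \<partial>lborel) \<in> borel_measurable lborel"
      by (rule lborel.borel_measurable_nn_integral)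
    then show ?thesis by (simp only: emeasure_fibre[OF Q G] measurable_lborel2)
  qed
  have "X = ball 0 \<rho> \<inter> (\<lambda>x. emeasure lborel {z\<in>ball 0 \<rho>. x - Q x + Q z \<in> G}) -` {\<delta>..}"
    by (auto simp: X_def)
  also have "\<dots> \<in> sets borel"
    using measurable_sets_borel[OF gm, of "{\<delta>..}"] by simp
  finally show Xm: "X \<in> sets borel" .
  have "\<delta> * emeasure lborel X = (\<integral>\<^sup>+x. \<delta> * indicator X x \<partial>lborel)"
    using Xm by (simp add: nn_integral_cmult)
  also have "\<dots> \<le> (\<integral>\<^sup>+x. emeasure lborel {y\<in>ball 0 (2*\<rho>). x + Q y \<in> G} \<partial>lborel)"
  proof (intro nn_integral_mono)
    fix x :: 'a
    show "\<delta> * indicator X x \<le> emeasure lborel {y\<in>ball 0 (2*\<rho>). x + Q y \<in> G}"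
    proof (cases "x \<in> X")
      case True
      then have x: "norm x < \<rho>" and "\<delta> \<le> emeasure lborel {z\<in>ball 0 \<rho>. x - Q x + Q z \<in> G}"
        by (auto simp: X_def)
      note this(2)
      \<comment> \<open>Substitution \<open>y = z - x\<close>. Both points lie in the ball of radius
        \<rho>, hence the doubled radius, and linearity gives
        \<open>x + Q y = x - Q x + Q z\<close>.\<close>
      also have "emeasure lborel {z\<in>ball 0 \<rho>. x - Q x + Q z \<in> G}
          = emeasure lborel {y. y + x \<in> {z\<in>ball 0 \<rho>. x - Q x + Q z \<in> G}}"
        by (rule emeasure_lborel_translate[symmetric]) (rule fibre_in_borel[OF Q G])
      also have "\<dots> \<le> emeasure lborel {y\<in>ball 0 (2*\<rho>). x + Q y \<in> G}"
      proof (rule emeasure_mono)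
        show "{y. y + x \<in> {z\<in>ball 0 \<rho>. x - Q x + Q z \<in> G}} \<subseteq> {y\<in>ball 0 (2*\<rho>). x + Q y \<in> G}"
        proof clarify
          fix y assume y: "y + x \<in> ball 0 \<rho>" "x - Q x + Q (y + x) \<in> G"
          have "norm y \<le> norm (y + x) + norm x" using norm_triangle_ineq4[of "y+x" x] by simp
          then show "y \<in> ball 0 (2*\<rho>) \<and> x + Q y \<in> G" using x y by (simp add: linear_add[OF Q])
        qed
      qed (use fibre_in_borel[OF Q G] in simp)
      finally show ?thesis using True by simp
    qed auto
  qed
  also have "\<dots> = emeasure lborel G * emeasure lborel (ball (0::'a) (2*\<rho>))"
    by (rule shear_fubini[OF Q G])
  finally show "\<delta> * emeasure lborel X \<le> emeasure lborel G * emeasure lborel (ball (0::'a) (2*\<rho>))" .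
qed

text \<open>The fibre bound is asked pointwise on \<open>X\<close>, so the conditions producing it
  may be chosen arbitrarily for each \<open>x\<close>; all of \<open>X\<close> lies in the Borel set
  \<open>?Y\<close> of points with a large fibre. Chaining the lemma multiplies the bounds and so
  adds the exponents of \<epsilon>.\<close>

lemma fibre_volume_ge:
  fixes Q :: "'a::euclidean_space \<Rightarrow> 'a"
  assumes Q: "linear Q" and G: "G \<in> sets borel" and \<rho>: "0 < \<rho>"
    and X: "X \<subseteq> ball 0 \<rho>" "ennreal c \<le> emeasure lborel X" "0 \<le> c" "0 \<le> \<delta>"
    and *: "\<And>x. x \<in> X \<Longrightarrow> ennreal \<delta> \<le> emeasure lborel {z\<in>ball 0 \<rho>. x - Q x + Q z \<in> G}"
  shows "ennreal (\<delta> * c / measure lborel (ball (0::'a) (2*\<rho>))) \<le> emeasure lborel G"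
proof -
  let ?b = "measure lborel (ball (0::'a) (2*\<rho>))"
  have b: "?b > 0" using \<rho> by (simp add: content_ball_pos)
  let ?Y = "{x\<in>ball 0 \<rho>. ennreal \<delta> \<le> emeasure lborel {z\<in>ball 0 \<rho>. x - Q x + Q z \<in> G}}"
  have sub: "X \<subseteq> ?Y"
    using X(1) * by blast
  have "emeasure lborel X \<le> emeasure lborel ?Y"
    by (rule emeasure_mono[OF sub]) (use fibre_volume(1)[OF Q G \<rho>, of "ennreal \<delta>"] in \<open>simp only: sets_lborel\<close>)
  then have "ennreal \<delta> * ennreal c \<le> ennreal \<delta> * emeasure lborel ?Y"
    using X(2) by (intro mult_left_mono) (auto intro: order_trans)
  also have "\<dots> \<le> emeasure lborel G * emeasure lborel (ball (0::'a) (2*\<rho>))"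
    by (rule fibre_volume[OF Q G \<rho>])
  also have "emeasure lborel (ball (0::'a) (2*\<rho>)) = ennreal ?b"
    by (rule emeasure_lborel_ball_eq)
  finally have le: "ennreal (\<delta> * c) \<le> emeasure lborel G * ennreal ?b"
    using X by (simp add: ennreal_mult)
  show ?thesis
  proof (cases "emeasure lborel G")
    case (real r)
    then have "\<delta> * c \<le> r * ?b" using le b X by (simp flip: ennreal_mult)
    then show ?thesis using real b by (simp add: ennreal_leI field_simps)
  qed simp
qed

section \<open>Codimension formula and tensor estimates\<close>

text \<open>As a function of \<open>r\<close> the right-hand side is a convex parabola with vertex
  at \<open>(N + H - M) / 2\<close>. In the middle regime \<open>r\<close> is the floor of the
  vertex, and missing it by one half costs the extra \<open>1 / 8\<close> of the odd case. Otherwise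
  the vertex lies outside the admissible range and \<open>r\<close> is the nearest endpoint:
  \<open>H\<close>, \<open>0\<close> or \<open>N\<close>.\<close>

lemma Ffun_eq_codim:
  obtains r where "r \<le> N" "r \<le> H" "Ffun N M H = real ((N - r) * (H - r) + r * M) / 2"
proof -
  define n m h where "n = int N" and "m = int M" and "h = int H"
  consider (mid) "\<bar>n - m\<bar> \<le> h \<and> h \<le> n + m" | (a) "\<not> (\<bar>n - m\<bar> \<le> h \<and> h \<le> n + m)" "h \<le> n - m"
    | (b) "\<not> (\<bar>n - m\<bar> \<le> h \<and> h \<le> n + m)" "\<not> h \<le> n - m" "h \<le> m - n"
    | (c) "\<not> (\<bar>n - m\<bar> \<le> h \<and> h \<le> n + m)" "\<not> h \<le> n - m" "\<not> h \<le> m - n" by blast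
  then show thesis
  proof cases
    case mid
    define r where "r = nat ((h + n - m) div 2)"
    have "0 \<le> h + n - m" using mid by linarith
    then have r: "int r = (h + n - m) div 2" by (simp add: r_def)
    have rle: "r \<le> N" "r \<le> H"
      using mid r unfolding n_def h_def m_def by linarith+
    have val: "real ((N - r) * (H - r) + r * M) = real_of_int ((n - int r) * (h - int r) + int r * m)"
      using rle by (simp add: n_def h_def m_def of_nat_diff)
    have halve: "f = real_of_int x / 2" if "8 * x = 2 * y" "f = real_of_int y / 8" for x y f
    proof -
      have "y = 4 * x" using that(1) by linarith
      then show ?thesis using that(2) by simp
    qed
    show thesis
    proof (cases "even (h + m - n)")
      case True
      then have "even (h + n - m)" by presburger
      then have m: "m = h + n - 2 * int r" using r by auto
      have eq: "8 * ((n - int r) * (h - int r) + int r * m) = 2 * (2 * (n * m + m * h + h * n) - (n^2 + m^2 + h^2))"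
        unfolding m by (simp add: algebra_simps power2_eq_square)
      have F: "Ffun N M H = real_of_int (2 * (n * m + m * h + h * n) - (n^2 + m^2 + h^2)) / 8"
        unfolding Ffun_def Let_def n_def[symmetric] m_def[symmetric] h_def[symmetric]
        by (rule trans[OF if_P[OF mid] if_P[OF True]])
      have "Ffun N M H = real ((N - r) * (H - r) + r * M) / 2"
        unfolding val by (rule halve[OF eq F])
      with rle show thesis by (rule that)
    next
      case False
      then have "odd (h + n - m)" by presburger
      then have m: "m = h + n - 2 * int r - 1" using r by presburger
      have eq: "8 * ((n - int r) * (h - int r) + int r * m) = 2 * (2 * (n * m + m * h + h * n) - (n^2 + m^2 + h^2) + 1)"
        unfolding m by (simp add: algebra_simps power2_eq_square)
      have F: "Ffun N M H = real_of_int (2 * (n * m + m * h + h * n) - (n^2 + m^2 + h^2) + 1) / 8"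
        unfolding Ffun_def Let_def n_def[symmetric] m_def[symmetric] h_def[symmetric]
        by (rule trans[OF if_P[OF mid] if_not_P[OF False]])
      have "Ffun N M H = real ((N - r) * (H - r) + r * M) / 2"
        unfolding val by (rule halve[OF eq F])
      with rle show thesis by (rule that)
    qed
  next
    case a
    have "Ffun N M H = real_of_int (m * h) / 2"
      unfolding Ffun_def Let_def n_def[symmetric] m_def[symmetric] h_def[symmetric]
      by (simp only: a if_False if_True)
    then show thesis using a by (intro that[of H]) (auto simp: n_def m_def h_def)
  next
    case b
    have "Ffun N M H = real_of_int (n * h) / 2"
      unfolding Ffun_def Let_def n_def[symmetric] m_def[symmetric] h_def[symmetric]
      by (simp only: b if_False if_True)
    then show thesis by (intro that[of 0]) (auto simp: n_def m_def h_def)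
  next
    case c
    have "Ffun N M H = real_of_int (n * m) / 2"
      unfolding Ffun_def Let_def n_def[symmetric] m_def[symmetric] h_def[symmetric]
      by (simp only: c if_False if_True)
    then show thesis using c by (intro that[of N]) (auto simp: n_def m_def h_def)
  qed
qed

text \<open>Orthonormal bases of \<open>span Y\<close> and of its orthogonal complement are joined.
  If \<open>Y\<close> is degenerate, \<open>W\<close> is padded with vectors of the complement to
  exactly \<open>r\<close> elements, so that the later counts of conditions do not depend on the
  rank of \<open>Y\<close>.\<close>

lemma orthonormal_basis_adapted:
  fixes Y :: "'a::euclidean_space set"
  assumes "finite Y" "card Y \<le> r" "r \<le> DIM('a)"
  obtains U W where "finite U" "card U = DIM('a)" "pairwise orthogonal U" "\<And>u. u \<in> U \<Longrightarrow> norm u = 1"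
    "span U = UNIV" "W \<subseteq> U" "card W = r" "\<And>u y. u \<in> U - W \<Longrightarrow> y \<in> Y \<Longrightarrow> u \<bullet> y = 0"
proof -
  obtain B where B: "B \<subseteq> span Y" "pairwise orthogonal B" "\<And>x. x \<in> B \<Longrightarrow> norm x = 1"
    "independent B" "card B = dim (span Y)" "span B = span Y"
    using orthonormal_basis_subspace[OF subspace_span] by metis
  define V where "V = {x. \<forall>y\<in>span Y. orthogonal y x}"
  have sV: "subspace V" unfolding V_def by (rule subspace_orthogonal_to_vectors)
  obtain B' where B': "B' \<subseteq> V" "pairwise orthogonal B'" "\<And>x. x \<in> B' \<Longrightarrow> norm x = 1"
    "independent B'" "card B' = dim V" "span B' = V"
    using orthonormal_basis_subspace[OF sV] by metis
  have dimV: "dim V + dim (span Y) = DIM('a)"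
    using dim_subspace_orthogonal_to_vectors[of "span Y" "UNIV::'a set"]
    by (simp add: V_def)
  have fin: "finite B" "finite B'"
    using B(4) B'(4) by (auto intro: independent_imp_finite)
  have orth: "orthogonal x y" if "x \<in> B" "y \<in> B'" for x y
    using that B(1) B'(1) by (auto simp: V_def)
  have disj: "B \<inter> B' = {}"
  proof -
    have "x = 0" if "x \<in> B" "x \<in> B'" for x
      using orth[OF that] by (simp add: orthogonal_def)
    moreover have "0 \<notin> B" using B(3) by force
    ultimately show ?thesis by blast
  qed
  have po: "pairwise orthogonal (B \<union> B')"
    using B(2) B'(2) orth unfolding pairwise_def by (metis Un_iff orthogonal_commute)
  have n1: "norm u = 1" if "u \<in> B \<union> B'" for u using that B(3) B'(3) by auto
  have cU: "card (B \<union> B') = DIM('a)"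
    using disj fin B(5) B'(5) dimV by (simp add: card_Un_disjoint)
  have "0 \<notin> B \<union> B'" using n1 by force
  then have ind: "independent (B \<union> B')" using po by (rule pairwise_orthogonal_independent[rotated])
  have spU: "span (B \<union> B') = UNIV"
    using card_eq_dim[of "B \<union> B'" UNIV] ind cU fin by auto
  have "card B \<le> r" using B(5) assms dim_le_card'[OF assms(1)] by simp
  then obtain W where W: "B \<subseteq> W" "W \<subseteq> B \<union> B'" "card W = r"
    using exists_subset_between[of B r "B \<union> B'"] assms(3) cU fin by auto
  have "u \<bullet> y = 0" if "u \<in> (B \<union> B') - W" "y \<in> Y" for u y
  proof -
    have "u \<in> V" using that W B' by blast
    then have "orthogonal y u" using that by (auto simp: V_def span_base)
    then show ?thesis by (simp add: orthogonal_def inner_commute)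
  qed
  then show thesis using fin cU po n1 spU W by (intro that[of "B \<union> B'" W]) auto
qed

section \<open>Perturbation of sums of rank-one tensors\<close>

lemma prod3_perturb:
  fixes x y z x' y' z' :: real
  assumes "\<bar>x\<bar> \<le> R" "\<bar>y\<bar> \<le> R" "\<bar>z\<bar> \<le> R" "\<bar>x' - x\<bar> \<le> \<epsilon>" "\<bar>y' - y\<bar> \<le> \<epsilon>" "\<bar>z' - z\<bar> \<le> \<epsilon>" "\<epsilon> \<le> 1"
  shows "\<bar>x' * y' * z' - x * y * z\<bar> \<le> 3 * (R + 1)\<^sup>2 * \<epsilon>"
proof -
  have y': "\<bar>y'\<bar> \<le> R + 1" and z': "\<bar>z'\<bar> \<le> R + 1" and x: "\<bar>x\<bar> \<le> R + 1" and y: "\<bar>y\<bar> \<le> R + 1"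
    using assms by linarith+
  have \<epsilon>: "0 \<le> \<epsilon>" and R: "0 \<le> R + 1" using assms by linarith+
  have "\<bar>(x' - x) * y' * z'\<bar> \<le> \<epsilon> * (R + 1) * (R + 1)"
    unfolding abs_mult by (intro mult_mono assms y' z' \<epsilon> R mult_nonneg_nonneg abs_ge_zero)
  moreover have "\<bar>x * (y' - y) * z'\<bar> \<le> (R + 1) * \<epsilon> * (R + 1)"
    unfolding abs_mult by (intro mult_mono assms x z' \<epsilon> R mult_nonneg_nonneg abs_ge_zero)
  moreover have "\<bar>x * y * (z' - z)\<bar> \<le> (R + 1) * (R + 1) * \<epsilon>"
    unfolding abs_mult by (intro mult_mono assms x y \<epsilon> R mult_nonneg_nonneg abs_ge_zero)
  moreover have "x' * y' * z' - x * y * z = (x' - x) * y' * z' + x * (y' - y) * z' + x * y * (z' - z)"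
    by (simp add: algebra_simps)
  ultimately have "\<bar>x' * y' * z' - x * y * z\<bar>
      \<le> \<epsilon> * (R + 1) * (R + 1) + (R + 1) * \<epsilon> * (R + 1) + (R + 1) * (R + 1) * \<epsilon>"
    by linarith
  then show ?thesis by (simp add: power2_eq_square algebra_simps)
qed

lemma finite_family_bound:
  fixes f :: "'i::finite \<Rightarrow> real"
  obtains R where "1 \<le> R" "\<And>i. \<bar>f i\<bar> \<le> R"
proof (rule that)
  show "\<bar>f i\<bar> \<le> 1 + (\<Sum>i\<in>UNIV. \<bar>f i\<bar>)" for i
    using member_le_sum[of i UNIV "\<lambda>i. \<bar>f i\<bar>"] by simp
qed (simp add: sum_nonneg)

text \<open>A rank-one tensor is invariant under rescaling its three factors by \<open>s, t, 1/(st)\<close>, which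
  saves two of the \<open>I + J + K\<close> linear conditions: one entry of each of \<open>a\<close> and \<open>b\<close> is left
  free and \<open>c\<close> is constrained near a moving centre. If \<open>a0 = 0\<close> (or \<open>b0 = 0\<close>), the conditions on \<open>a\<close>
  (or \<open>b\<close>) alone suffice.\<close>
lemma rank_one_conditions:
  fixes a0 :: "'i::finite \<Rightarrow> real" and b0 :: "'j::finite \<Rightarrow> real" and c0 :: "'k::finite \<Rightarrow> real"
  assumes \<sigma>: "0 < \<sigma>"
  obtains IA :: "'i set" and JB :: "'j set" and KC :: "'k set" and i0 j0 p q \<gamma> \<rho>0 M
  where "card IA + card JB + card KC + 2 \<le> CARD('i) + CARD('j) + CARD('k)" "0 < \<rho>0" "0 \<le> M"
    "\<And>\<alpha> \<beta> k. \<bar>\<alpha>\<bar> \<le> \<rho>0 \<Longrightarrow> \<bar>\<beta>\<bar> \<le> \<rho>0 \<Longrightarrow> \<bar>\<gamma> \<alpha> \<beta> * c0 k - c0 k\<bar> \<le> \<sigma>"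
    "\<And>a b c \<epsilon> i j k. \<lbrakk>\<epsilon> \<le> 1; \<And>i. \<bar>a i\<bar> \<le> \<rho>0; \<And>j. \<bar>b j\<bar> \<le> \<rho>0; \<And>k. \<bar>c k\<bar> \<le> 1;
        \<And>i. i \<in> IA \<Longrightarrow> \<bar>a i - p i * a i0\<bar> < \<epsilon>; \<And>j. j \<in> JB \<Longrightarrow> \<bar>b j - q j * b j0\<bar> < \<epsilon>;
        \<And>k. k \<in> KC \<Longrightarrow> \<bar>c0 k + c k - \<gamma> (a i0) (b j0) * c0 k\<bar> < \<epsilon>; 0 < \<epsilon>\<rbrakk>
      \<Longrightarrow> \<bar>(a0 i + a i) * (b0 j + b j) * (c0 k + c k) - a0 i * b0 j * c0 k\<bar> \<le> M * \<epsilon>"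
proof -
  obtain Ra where Ra: "1 \<le> Ra" "\<And>i. \<bar>a0 i\<bar> \<le> Ra" using finite_family_bound[of a0] by blast
  obtain Rb where Rb: "1 \<le> Rb" "\<And>i. \<bar>b0 i\<bar> \<le> Rb" using finite_family_bound[of b0] by blast
  obtain Rc where Rc: "1 \<le> Rc" "\<And>i. \<bar>c0 i\<bar> \<le> Rc" using finite_family_bound[of c0] by blast
  \<comment> \<open>The factor 4 leaves room for the rescaled truth: \<open>s\<close> and
    \<open>t\<close> are at most 2 and \<open>1 / (s t)\<close> at most 4 in absolute value, so all
    three rescaled factors stay below \<open>R\<close>.\<close>
  define R where "R = 4 * (Ra + Rb + Rc)"
  have a0: "\<bar>a0 i\<bar> \<le> R / 4" for i using Ra Rb Rc by (simp add: R_def add_increasing2)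
  have b0: "\<bar>b0 i\<bar> \<le> R / 4" for i using Ra(1) Rb(2)[of i] Rc(1) by (simp add: R_def)
  have c0: "\<bar>c0 i\<bar> \<le> R / 4" for i using Ra(1) Rb(1) Rc(2)[of i] by (simp add: R_def)
  have R: "4 \<le> R" using Ra(1) Rb(1) Rc(1) by (simp add: R_def)
  have cards: "1 \<le> CARD('i)" "1 \<le> CARD('j)" "1 \<le> CARD('k)" by (simp_all add: Suc_leI)
  then have cards2: "2 \<le> CARD('j) + CARD('k)" "2 \<le> CARD('i) + CARD('k)" by linarith+
  consider "\<And>i. a0 i = 0" | "\<And>j. b0 j = 0" | i0 j0 where "a0 i0 \<noteq> 0" "b0 j0 \<noteq> 0" by blast
  then show thesis
  proof cases
    case 1
    show thesis
    \<comment> \<open>The coefficient 0 silences the entry at \<open>undefined\<close>, so the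
      conditions are just \<open>\<bar>a i\<bar> < \<epsilon>\<close>. Having none on
      \<open>b\<close> and \<open>c\<close> saves at least two.\<close>
    proof (rule that[of "UNIV" "{}" "{}" 1 "3 * (R + 1)\<^sup>2" "\<lambda>_ _. 1" "\<lambda>_. 0" undefined "\<lambda>_. 0" undefined])
      fix a :: "'i \<Rightarrow> real" and b :: "'j \<Rightarrow> real" and c :: "'k \<Rightarrow> real" and \<epsilon> i j k
      assume *: "\<epsilon> \<le> 1" "\<And>j. \<bar>b j :: real\<bar> \<le> 1" "\<And>k. \<bar>c k :: real\<bar> \<le> 1"
        "\<And>i. i \<in> UNIV \<Longrightarrow> \<bar>a i - 0 * a undefined\<bar> < \<epsilon>" "0 < \<epsilon>"
      have "\<bar>(a0 i + a i) * (b0 j + b j) * (c0 k + c k) - 0 * (b0 j + b j) * (c0 k + c k)\<bar> \<le> 3 * (R + 1)\<^sup>2 * \<epsilon>"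
        using *(1,4) *(2)[of j] *(3)[of k] b0[of j] c0[of k] R less_imp_le[OF *(4)[of i]] *(5) 1[of i] by (intro prod3_perturb) auto
      then show "\<bar>(a0 i + a i) * (b0 j + b j) * (c0 k + c k) - a0 i * b0 j * c0 k\<bar> \<le> 3 * (R + 1)\<^sup>2 * \<epsilon>"
        using 1 by simp
    qed (use cards2 \<sigma> in auto)
  next
    case 2
    show thesis
    proof (rule that[of "{}" "UNIV" "{}" 1 "3 * (R + 1)\<^sup>2" "\<lambda>_ _. 1" "\<lambda>_. 0" undefined "\<lambda>_. 0" undefined])
      fix a :: "'i \<Rightarrow> real" and b :: "'j \<Rightarrow> real" and c :: "'k \<Rightarrow> real" and \<epsilon> i j k
      assume *: "\<epsilon> \<le> 1" "\<And>i. \<bar>a i :: real\<bar> \<le> 1" "\<And>k. \<bar>c k :: real\<bar> \<le> 1"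
        "\<And>i. i \<in> UNIV \<Longrightarrow> \<bar>b i - 0 * b undefined\<bar> < \<epsilon>" "0 < \<epsilon>"
      have "\<bar>(a0 i + a i) * (b0 j + b j) * (c0 k + c k) - (a0 i + a i) * 0 * (c0 k + c k)\<bar> \<le> 3 * (R + 1)\<^sup>2 * \<epsilon>"
        using *(1,4) *(2)[of i] *(3)[of k] a0[of i] c0[of k] R less_imp_le[OF *(4)[of j]] *(5) 2[of j] by (intro prod3_perturb) auto
      then show "\<bar>(a0 i + a i) * (b0 j + b j) * (c0 k + c k) - a0 i * b0 j * c0 k\<bar> \<le> 3 * (R + 1)\<^sup>2 * \<epsilon>"
        using 2 by simp
    qed (use cards2 \<sigma> in auto)
  next
    case 3
    \<comment> \<open>The bound \<open>1/2\<close> keeps \<open>s t \<ge> 1/4\<close>; the bound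
      \<open>\<sigma> / (10 * R)\<close> makes the drift of the centre, estimated by
      \<open>4 * (10 * \<eta>) * (R / 4)\<close>, at most \<sigma>.\<close>
    define \<eta> where "\<eta> = min (1/2) (\<sigma> / (10 * R))"
    have \<eta>: "0 < \<eta>" "\<eta> \<le> 1/2" "10 * \<eta> * R \<le> \<sigma>"
      using \<sigma> R by (auto simp: \<eta>_def min_def field_simps)
    define \<rho>0 where "\<rho>0 = \<eta> * min \<bar>a0 i0\<bar> \<bar>b0 j0\<bar>"
    have \<rho>0: "0 < \<rho>0" using \<eta> 3 by (simp add: \<rho>0_def)
    \<comment> \<open>\<open>s \<alpha>\<close> is the scaling of \<open>a0\<close> read off from
      the displacement \<alpha> of its free entry; \<open>t\<close> does the same for
      \<open>b0\<close>.\<close>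
    define s where "s \<alpha> = 1 + \<alpha> / a0 i0" for \<alpha>
    define t where "t \<beta> = 1 + \<beta> / b0 j0" for \<beta>
    have s1: "\<bar>s \<alpha> - 1\<bar> \<le> \<eta>" if "\<bar>\<alpha>\<bar> \<le> \<rho>0" for \<alpha>
    proof -
      have "\<eta> * min \<bar>a0 i0\<bar> \<bar>b0 j0\<bar> \<le> \<eta> * \<bar>a0 i0\<bar>"
        using \<eta> by (intro mult_left_mono) auto
      then have "\<bar>\<alpha>\<bar> \<le> \<eta> * \<bar>a0 i0\<bar>" using that unfolding \<rho>0_def by linarith
      then show ?thesis using 3 by (simp add: s_def divide_le_eq)
    qed
    have t1: "\<bar>t \<alpha> - 1\<bar> \<le> \<eta>" if "\<bar>\<alpha>\<bar> \<le> \<rho>0" for \<alpha>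
    proof -
      have "\<eta> * min \<bar>a0 i0\<bar> \<bar>b0 j0\<bar> \<le> \<eta> * \<bar>b0 j0\<bar>"
        using \<eta> by (intro mult_left_mono) auto
      then have "\<bar>\<alpha>\<bar> \<le> \<eta> * \<bar>b0 j0\<bar>" using that unfolding \<rho>0_def by linarith
      then show ?thesis using 3 by (simp add: t_def divide_le_eq)
    qed
    have st: "\<bar>s \<alpha>\<bar> \<le> 2" "1/4 \<le> s \<alpha> * t \<beta>" "\<bar>t \<beta>\<bar> \<le> 2" if "\<bar>\<alpha>\<bar> \<le> \<rho>0" "\<bar>\<beta>\<bar> \<le> \<rho>0" for \<alpha> \<beta>
    proof -
      have *: "1/2 \<le> s \<alpha>" "1/2 \<le> t \<beta>" and "\<bar>s \<alpha>\<bar> \<le> 2" "\<bar>t \<beta>\<bar> \<le> 2"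
        using s1[OF that(1)] t1[OF that(2)] \<eta>(2) by linarith+
      then show "\<bar>s \<alpha>\<bar> \<le> 2" "\<bar>t \<beta>\<bar> \<le> 2" by auto
      show "1/4 \<le> s \<alpha> * t \<beta>" using mult_mono[OF *] * by simp
    qed
    have inv: "\<bar>1 / (s \<alpha> * t \<beta>)\<bar> \<le> 4" if "\<bar>\<alpha>\<bar> \<le> \<rho>0" "\<bar>\<beta>\<bar> \<le> \<rho>0" for \<alpha> \<beta>
      using st(2)[OF that] by (simp add: divide_le_eq)
    show thesis
    proof (rule that[of "-{i0}" "-{j0}" "UNIV" \<rho>0 "3 * (R + 1)\<^sup>2" "\<lambda>\<alpha> \<beta>. 1 / (s \<alpha> * t \<beta>)"
            "\<lambda>i. a0 i / a0 i0" i0 "\<lambda>j. b0 j / b0 j0" j0])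
      show "card (- {i0}) + card (- {j0}) + card (UNIV::'k set) + 2 \<le> CARD('i) + CARD('j) + CARD('k)"
      proof -
        have "card (- {i0}) = CARD('i) - 1" "card (- {j0}) = CARD('j) - 1"
          by (simp_all add: Compl_eq_Diff_UNIV)
        then show ?thesis using cards by linarith
      qed
      show "0 < \<rho>0" by fact
    next
      fix \<alpha> \<beta> k assume *: "\<bar>\<alpha>\<bar> \<le> \<rho>0" "\<bar>\<beta>\<bar> \<le> \<rho>0"
      have "s \<alpha> * t \<beta> \<noteq> 0" using st(2)[OF *] by linarith
      then have "1 / (s \<alpha> * t \<beta>) * c0 k - c0 k = (1 / (s \<alpha> * t \<beta>)) * ((1 - s \<alpha>) * t \<beta> + (1 - t \<beta>)) * c0 k"
        by (simp add: field_simps)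
      also have "\<bar>\<dots>\<bar> \<le> 4 * (10 * \<eta>) * (R / 4)"
      proof -
        have "\<bar>(1 - s \<alpha>) * t \<beta>\<bar> \<le> \<eta> * 2"
          unfolding abs_mult using s1[OF *(1)] st(3)[OF *] \<eta> by (intro mult_mono) auto
        then have "\<bar>(1 - s \<alpha>) * t \<beta> + (1 - t \<beta>)\<bar> \<le> 10 * \<eta>"
          using t1[OF *(2)] \<eta> by linarith
        then show ?thesis
          unfolding abs_mult[of "_ * _" "c0 k"] abs_mult[of "1 / _"] using inv[OF *] c0 \<eta> R
          by (intro mult_mono) auto
      qed
      also have "\<dots> \<le> \<sigma>" using \<eta>(3) by (simp add: ac_simps)
      finally show "\<bar>1 / (s \<alpha> * t \<beta>) * c0 k - c0 k\<bar> \<le> \<sigma>" .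
    next
      fix a :: "'i \<Rightarrow> real" and b :: "'j \<Rightarrow> real" and c :: "'k \<Rightarrow> real" and \<epsilon> i j k
      assume *: "\<epsilon> \<le> 1" "\<And>i. \<bar>a i\<bar> \<le> \<rho>0" "\<And>j. \<bar>b j\<bar> \<le> \<rho>0" "\<And>k. \<bar>c k :: real\<bar> \<le> 1"
        "\<And>i. i \<in> -{i0} \<Longrightarrow> \<bar>a i - a0 i / a0 i0 * a i0\<bar> < \<epsilon>"
        "\<And>j. j \<in> -{j0} \<Longrightarrow> \<bar>b j - b0 j / b0 j0 * b j0\<bar> < \<epsilon>"
        "\<And>k. k \<in> UNIV \<Longrightarrow> \<bar>c0 k + c k - 1 / (s (a i0) * t (b j0)) * c0 k\<bar> < \<epsilon>" "0 < \<epsilon>"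
      let ?s = "s (a i0)" and ?t = "t (b j0)"
      note ab = *(2)[of i0] *(3)[of j0]
      have nz: "?s \<noteq> 0" "?t \<noteq> 0" using st(2)[OF ab] by auto
      have A: "\<bar>(a0 i + a i) - ?s * a0 i\<bar> \<le> \<epsilon>"
      proof -
        have "(a0 i + a i) - ?s * a0 i = a i - a0 i / a0 i0 * a i0"
          by (simp add: s_def algebra_simps)
        then show ?thesis using *(5)[of i] *(8) 3 by (cases "i = i0") auto
      qed
      have B: "\<bar>(b0 j + b j) - ?t * b0 j\<bar> \<le> \<epsilon>"
      proof -
        have "(b0 j + b j) - ?t * b0 j = b j - b0 j / b0 j0 * b j0"
          by (simp add: t_def algebra_simps)
        then show ?thesis using *(6)[of j] *(8) 3 by (cases "j = j0") auto
      qed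
      \<comment> \<open>The comparison point is the rescaled truth, with factors
        \<open>?s * a0\<close>, \<open>?t * b0\<close> and \<open>1 / (?s * ?t) * c0\<close>; its
        triple products are those of the truth.\<close>
      have "\<bar>?s * a0 i\<bar> \<le> 2 * (R / 4)" "\<bar>?t * b0 j\<bar> \<le> 2 * (R / 4)" "\<bar>1 / (?s * ?t) * c0 k\<bar> \<le> 4 * (R / 4)"
        unfolding abs_mult[of _ "a0 i"] abs_mult[of _ "b0 j"] abs_mult[of _ "c0 k"]
        using R by (intro mult_mono st[OF ab] inv[OF ab] a0 b0 c0 abs_ge_zero; simp)+
      then have "\<bar>(a0 i + a i) * (b0 j + b j) * (c0 k + c k) - (?s * a0 i) * (?t * b0 j) * (1 / (?s * ?t) * c0 k)\<bar>
          \<le> 3 * (R + 1)\<^sup>2 * \<epsilon>"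
        by (intro prod3_perturb A B *(1)) (use *(7)[of k] R in \<open>linarith | simp\<close>)+
      moreover have "(?s * a0 i) * (?t * b0 j) * (1 / (?s * ?t) * c0 k) = a0 i * b0 j * c0 k"
        using nz by simp
      ultimately show "\<bar>(a0 i + a i) * (b0 j + b j) * (c0 k + c k) - a0 i * b0 j * c0 k\<bar> \<le> 3 * (R + 1)\<^sup>2 * \<epsilon>"
        by simp
    qed auto
  qed
qed

lemma norm_le_sum_orthonormal:
  fixes y :: "'a::euclidean_space"
  assumes "pairwise orthogonal U" "\<And>u. u \<in> U \<Longrightarrow> norm u = 1" "span U = UNIV" "finite U"
  shows "norm y \<le> (\<Sum>u\<in>U. \<bar>u \<bullet> y\<bar>)"
proof -
  have "y = (\<Sum>u\<in>U. (y \<bullet> u) *\<^sub>R u)"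
    using orthonormal_basis_expand[of U y] assms by auto
  then have "norm y \<le> (\<Sum>u\<in>U. norm ((y \<bullet> u) *\<^sub>R u))"
    by (metis norm_sum)
  also have "\<dots> = (\<Sum>u\<in>U. \<bar>u \<bullet> y\<bar>)"
    using assms(2) by (intro sum.cong) (auto simp: inner_commute)
  finally show ?thesis .
qed

text \<open>The three summands of the constant belong to three groups of columns: \<open>h0\<close>,
  the rest of \<open>S\<close>, and \<open>- S\<close>. Outside \<open>S\<close> the truth vanishes,
  so slice \<open>k\<close> of the error is the matrix
  \<open>Y = (\<Sum>h\<in>-S. c k h *\<^sub>R X h)\<close>. Its coordinates along
  \<open>U - W\<close> are small term by term, those along \<open>W\<close> after summation, by the
  conditions on \<open>c\<close>.\<close>

lemma tensor_estimate:
  fixes a a0 :: "'i::finite \<Rightarrow> 'h::finite \<Rightarrow> real" and b b0 :: "'j::finite \<Rightarrow> 'h \<Rightarrow> real"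
    and c c0 :: "'k::finite \<Rightarrow> 'h \<Rightarrow> real" and X :: "'h \<Rightarrow> real^'j^'i"
  assumes h0: "h0 \<in> S" and \<epsilon>: "0 < \<epsilon>" "\<epsilon> \<le> 1"
    and pad: "\<And>i h. h \<notin> S \<Longrightarrow> a0 i h = 0" "\<And>j h. h \<notin> S \<Longrightarrow> b0 j h = 0" "\<And>k h. h \<notin> S \<Longrightarrow> c0 k h = 0"
    and \<Omega>: "\<And>i h. \<bar>a0 i h\<bar> \<le> \<Omega>" "\<And>j h. \<bar>b0 j h\<bar> \<le> \<Omega>" "\<And>k h. \<bar>c0 k h\<bar> \<le> \<Omega>"
    and c1: "\<And>k h. \<bar>c k h\<bar> \<le> 1"
    and near: "\<And>i h. h \<in> S - {h0} \<Longrightarrow> \<bar>a i h\<bar> < \<epsilon>" "\<And>j h. h \<in> S - {h0} \<Longrightarrow> \<bar>b j h\<bar> < \<epsilon>"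
      "\<And>k h. h \<in> S - {h0} \<Longrightarrow> \<bar>c k h\<bar> < \<epsilon>"
    and near0: "\<And>i j k. \<bar>(a0 i h0 + a i h0) * (b0 j h0 + b j h0) * (c0 k h0 + c k h0)
        - a0 i h0 * b0 j h0 * c0 k h0\<bar> \<le> M * \<epsilon>"
    and X: "\<And>h i j. X h $ i $ j = a i h * b j h"
    and U: "finite U" "pairwise orthogonal U" "\<And>u. u \<in> U \<Longrightarrow> norm u = 1" "span U = UNIV" "card U = N"
    and UW: "\<And>u h. u \<in> U - W \<Longrightarrow> h \<notin> S \<Longrightarrow> \<bar>u \<bullet> X h\<bar> \<le> \<epsilon>"
    and W: "\<And>u k. u \<in> U \<inter> W \<Longrightarrow> \<bar>\<Sum>h\<in>-S. (u \<bullet> X h) * c k h\<bar> \<le> \<epsilon>"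
  shows "\<bar>(\<Sum>h\<in>UNIV. (a0 i h + a i h) * (b0 j h + b j h) * (c0 k h + c k h)) - (\<Sum>h\<in>UNIV. a0 i h * b0 j h * c0 k h)\<bar>
    \<le> (M + real CARD('h) * (3 * (\<Omega> + 1)\<^sup>2) + real N * (real CARD('h) + 1)) * \<epsilon>"
proof -
  define d where "d h = (a0 i h + a i h) * (b0 j h + b j h) * (c0 k h + c k h) - a0 i h * b0 j h * c0 k h" for h
  have split: "(\<Sum>h\<in>UNIV. d h) = d h0 + (\<Sum>h\<in>S - {h0}. d h) + (\<Sum>h\<in>-S. d h)"
  proof -
    have "(\<Sum>h\<in>UNIV. d h) = (\<Sum>h\<in>S. d h) + (\<Sum>h\<in>-S. d h)"
      by (subst sum.union_disjoint[symmetric]) (auto simp: Compl_partition)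
    also have "(\<Sum>h\<in>S. d h) = d h0 + (\<Sum>h\<in>S - {h0}. d h)"
      using h0 by (intro sum.remove) auto
    finally show ?thesis .
  qed
  have "\<bar>d h0\<bar> \<le> M * \<epsilon>" using near0[of i j k] by (simp add: d_def)
  moreover have "\<bar>\<Sum>h\<in>S - {h0}. d h\<bar> \<le> real CARD('h) * (3 * (\<Omega> + 1)\<^sup>2) * \<epsilon>"
  proof -
    have dh: "\<bar>d h\<bar> \<le> 3 * (\<Omega> + 1)\<^sup>2 * \<epsilon>" if "h \<in> S - {h0}" for h
      unfolding d_def using near(1)[OF that, of i] near(2)[OF that, of j] near(3)[OF that, of k] \<epsilon>(2)
      by (intro prod3_perturb \<Omega>) auto
    have "\<bar>\<Sum>h\<in>S - {h0}. d h\<bar> \<le> (\<Sum>h\<in>S - {h0}. 3 * (\<Omega> + 1)\<^sup>2 * \<epsilon>)"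
      by (intro order_trans[OF sum_abs] sum_mono dh)
    also have "\<dots> = real (card (S - {h0})) * (3 * (\<Omega> + 1)\<^sup>2 * \<epsilon>)" by simp
    also have "\<dots> \<le> real CARD('h) * (3 * (\<Omega> + 1)\<^sup>2 * \<epsilon>)"
      using \<epsilon>(1) by (intro mult_right_mono of_nat_mono card_mono) auto
    finally show ?thesis by (simp add: mult.assoc)
  qed
  moreover have "\<bar>\<Sum>h\<in>-S. d h\<bar> \<le> real N * (real CARD('h) + 1) * \<epsilon>"
  proof -
    define Y where "Y = (\<Sum>h\<in>-S. c k h *\<^sub>R X h)"
    have "(\<Sum>h\<in>-S. d h) = Y $ i $ j"
      unfolding Y_def sum_component vector_scaleR_component X d_def
      by (intro sum.cong) (auto simp: pad)
    also have "\<bar>Y $ i $ j\<bar> \<le> norm Y"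
      by (rule order_trans[OF component_le_norm_cart Finite_Cartesian_Product.norm_nth_le])
    also have "\<dots> \<le> (\<Sum>u\<in>U. \<bar>u \<bullet> Y\<bar>)" by (intro norm_le_sum_orthonormal U)
    also have "\<dots> \<le> (\<Sum>u\<in>U. (real CARD('h) + 1) * \<epsilon>)"
    proof (intro sum_mono)
      fix u assume u: "u \<in> U"
      have uY: "u \<bullet> Y = (\<Sum>h\<in>-S. (u \<bullet> X h) * c k h)"
        by (simp add: Y_def inner_sum_right mult.commute)
      show "\<bar>u \<bullet> Y\<bar> \<le> (real CARD('h) + 1) * \<epsilon>"
      proof (cases "u \<in> W")
        case True
        then have "\<bar>u \<bullet> Y\<bar> \<le> 1 * \<epsilon>" unfolding uY using W[of u k] u by simp
        also have "\<dots> \<le> (real CARD('h) + 1) * \<epsilon>" using \<epsilon>(1) by (intro mult_right_mono) auto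
        finally show ?thesis .
      next
        case False
        have "\<bar>u \<bullet> Y\<bar> \<le> (\<Sum>h\<in>-S. \<epsilon> * 1)"
          unfolding uY
        proof (intro order_trans[OF sum_abs] sum_mono)
          fix h assume "h \<in> -S"
          then show "\<bar>u \<bullet> X h * c k h\<bar> \<le> \<epsilon> * 1"
            unfolding abs_mult using UW[of u h] u False c1 \<epsilon> by (intro mult_mono) auto
        qed
        also have "\<dots> = real (card (-S)) * \<epsilon>" by simp
        also have "\<dots> \<le> (real CARD('h) + 1) * \<epsilon>"
          using \<epsilon>(1) card_mono[of UNIV "-S"] by (intro mult_right_mono) (auto intro: le_less_trans simp: add_increasing2)
        finally show ?thesis .
      qed
    qed
    also have "\<dots> = real N * (real CARD('h) + 1) * \<epsilon>" using U by simp
    finally show ?thesis .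
  qed
  ultimately have "\<bar>\<Sum>h\<in>UNIV. d h\<bar> \<le> M * \<epsilon> + real CARD('h) * (3 * (\<Omega> + 1)\<^sup>2) * \<epsilon> + real N * (real CARD('h) + 1) * \<epsilon>"
    unfolding split by linarith
  then show ?thesis unfolding d_def sum_subtractf by (simp only: distrib_right)
qed

section \<open>Volume of a neighbourhood of the fibre\<close>

definition coord_proj :: "'a set \<Rightarrow> 'a \<Rightarrow> 'a::euclidean_space" where
  "coord_proj D x = (\<Sum>b\<in>D. (x \<bullet> b) *\<^sub>R b)"

lemma linear_coord_proj: "linear (coord_proj D)"
  by (rule linearI)
     (simp_all add: coord_proj_def inner_add_left scaleR_add_left sum.distrib scaleR_sum_right)

lemma coord_proj_inner:
  assumes "D \<subseteq> Basis" "b \<in> Basis"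
  shows "coord_proj D x \<bullet> b = (if b \<in> D then x \<bullet> b else 0)"
proof -
  have fD: "finite D" using assms(1) finite_Basis by (rule finite_subset)
  have "coord_proj D x \<bullet> b = (\<Sum>d\<in>D. (x \<bullet> d) * (d \<bullet> b))"
    by (simp add: coord_proj_def inner_sum_left)
  also have "\<dots> = (\<Sum>d\<in>D. if d = b then x \<bullet> b else 0)"
    using assms by (intro sum.cong) (auto simp: inner_Basis)
  also have "\<dots> = (if b \<in> D then x \<bullet> b else 0)"
    using fD by simp
  finally show ?thesis .
qed

text \<open>This is the meaning of the fibre expression \<open>x - Q x + Q z\<close>: the variables
  in \<open>D\<close> are redrawn from \<open>z\<close>, all others stay as fixed in
  \<open>x\<close>.\<close>

lemma coord_exchange_inner:
  assumes "D \<subseteq> Basis" "b \<in> Basis"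
  shows "(x - coord_proj D x + coord_proj D z) \<bullet> b = (if b \<in> D then z \<bullet> b else x \<bullet> b)"
  using coord_proj_inner[OF assms] by (simp add: inner_diff_left inner_add_left)

lemma norm_coord_exchange:
  assumes "D \<subseteq> Basis"
  shows "norm (x - coord_proj D x + coord_proj D z) \<le> norm x + norm z"
proof -
  have "norm (x - coord_proj D x) \<le> norm x" "norm (coord_proj D z) \<le> norm z"
    using assms by (auto intro!: norm_le_componentwise simp: inner_diff_left coord_proj_inner)
  then show ?thesis using norm_triangle_ineq[of "x - coord_proj D x" "coord_proj D z"] by linarith
qed

text \<open>The factors enter through families of basis vectors of one space rather than as three
  matrices. A cyclic change of roles is then a permutation of arguments that leaves Lebesgue measure
  untouched.\<close>

definition tensor_entry ::
  "('i \<Rightarrow> 'h::finite \<Rightarrow> 'a::euclidean_space) \<Rightarrow> ('j \<Rightarrow> 'h \<Rightarrow> 'a) \<Rightarrow> ('k \<Rightarrow> 'h \<Rightarrow> 'a) \<Rightarrow> 'a \<Rightarrow> 'i \<Rightarrow> 'j \<Rightarrow> 'k \<Rightarrow> real"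
  where "tensor_entry eA eB eC w i j k = (\<Sum>h\<in>UNIV. (w \<bullet> eA i h) * (w \<bullet> eB j h) * (w \<bullet> eC k h))"

lemma continuous_on_tensor_entry [continuous_intros]:
  "continuous_on A f \<Longrightarrow> continuous_on A (\<lambda>w. tensor_entry eA eB eC (f w) i j k)"
  unfolding tensor_entry_def by (intro continuous_intros)

lemma norm_sum_Basis_le:
  assumes "\<And>t. t \<in> T \<Longrightarrow> e t \<in> Basis" "\<And>t. t \<in> T \<Longrightarrow> \<bar>f t\<bar> \<le> c"
  shows "norm (\<Sum>t\<in>T. f t *\<^sub>R e t) \<le> real (card T) * c"
  using assms by (intro sum_norm_bound) auto

text \<open>Stage one supplies all of \<open>A\<close> and the columns of \<open>B\<close> outside
  \<open>R2\<close>, stage two the columns of \<open>B\<close> in \<open>R2\<close>, stage three all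
  of \<open>C\<close>; here \<open>R2\<close> is what remains of \<open>- S\<close> after setting
  \<open>r\<close> columns aside. Each condition is then linear in the coordinates of the current
  stage. The vector \<open>w\<close> is the displacement from \<open>w0\<close>, so in the columns
  outside \<open>S\<close> it is the factor itself.\<close>

lemma tensor_fibre_volume:
  fixes eA :: "'i::finite \<Rightarrow> 'h::finite \<Rightarrow> 'e::euclidean_space" and eB :: "'j::finite \<Rightarrow> 'h \<Rightarrow> 'e"
    and eC :: "'k::finite \<Rightarrow> 'h \<Rightarrow> 'e" and w0 :: 'e and S :: "'h set"
  assumes Bas: "\<And>i h. eA i h \<in> Basis" "\<And>j h. eB j h \<in> Basis" "\<And>k h. eC k h \<in> Basis"
    and inj: "\<And>j h j' h'. eB j h = eB j' h' \<Longrightarrow> j = j' \<and> h = h'"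
      "\<And>k h k' h'. eC k h = eC k' h' \<Longrightarrow> k = k' \<and> h = h'"
    and disj: "\<And>i h j h'. eA i h \<noteq> eB j h'" "\<And>i h k h'. eA i h \<noteq> eC k h'" "\<And>j h k h'. eB j h \<noteq> eC k h'"
    and pad: "\<And>i h. h \<notin> S \<Longrightarrow> w0 \<bullet> eA i h = 0" "\<And>j h. h \<notin> S \<Longrightarrow> w0 \<bullet> eB j h = 0"
      "\<And>k h. h \<notin> S \<Longrightarrow> w0 \<bullet> eC k h = 0"
    and h0: "h0 \<in> S" and r: "r \<le> card (- S)" "r \<le> CARD('i) * CARD('j)" and \<sigma>: "0 < \<sigma>"
  defines "n \<equiv> card S * (CARD('i) + CARD('j) + CARD('k)) - 2
      + ((CARD('i) * CARD('j) - r) * (card (- S) - r) + r * CARD('k))"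
  shows "\<exists>c>0. \<exists>M>0. \<forall>\<epsilon>. 0 < \<epsilon> \<longrightarrow> \<epsilon> \<le> 1 \<longrightarrow> ennreal (c * \<epsilon> ^ n) \<le> emeasure lborel {w. norm w \<le> \<sigma> \<and>
      (\<forall>i j k. \<bar>tensor_entry eA eB eC (w0 + w) i j k - tensor_entry eA eB eC w0 i j k\<bar> \<le> M * \<epsilon>)}"
proof -
  define N where "N = CARD('i) * CARD('j)"
  \<comment> \<open>\<open>\<rho> \<le> 1/2\<close> keeps every coordinate of the points involved at
    most 1; \<open>2 * \<rho> \<le> \<sigma>\<close> is needed because an exchange of coordinates
    can add two norms below \<rho>.\<close>
  define \<rho> where "\<rho> = min (1/2) (\<sigma> / 2)"
  have \<rho>: "0 < \<rho>" "\<rho> \<le> 1/2" "2 * \<rho> \<le> \<sigma>" using \<sigma> by (auto simp: \<rho>_def)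
  define \<Omega> where "\<Omega> = norm w0"
  \<comment> \<open>Tolerance for the drift of each entry of column \<open>h0\<close> of
    \<open>C\<close>: over all \<open>CARD('k)\<close> entries it adds up to at most
    \<open>\<rho> / 2\<close>.\<close>
  have \<sigma>': "0 < \<rho> / (2 * real CARD('k))" using \<rho> by simp
  show ?thesis
  proof (rule rank_one_conditions[where ?a0.0 = "\<lambda>i. w0 \<bullet> eA i h0" and ?b0.0 = "\<lambda>j. w0 \<bullet> eB j h0"
        and ?c0.0 = "\<lambda>k. w0 \<bullet> eC k h0", OF \<sigma>'])
    fix IA :: "'i set" and JB :: "'j set" and KC :: "'k set" and i0 j0 p q \<gamma> \<rho>0 Mc
    assume cardc: "card IA + card JB + card KC + 2 \<le> CARD('i) + CARD('j) + CARD('k)"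
    and \<rho>0: "0 < \<rho>0" and Mc: "0 \<le> Mc"
    and \<gamma>: "\<And>\<alpha> \<beta> k. \<bar>\<alpha>\<bar> \<le> \<rho>0 \<Longrightarrow> \<bar>\<beta>\<bar> \<le> \<rho>0 \<Longrightarrow>
      \<bar>\<gamma> \<alpha> \<beta> * (w0 \<bullet> eC k h0) - w0 \<bullet> eC k h0\<bar> \<le> \<rho> / (2 * real CARD('k))"
    and col: "\<And>a b c \<epsilon> i j k. \<lbrakk>\<epsilon> \<le> 1; \<And>i. \<bar>a i\<bar> \<le> \<rho>0; \<And>j. \<bar>b j\<bar> \<le> \<rho>0; \<And>k. \<bar>c k\<bar> \<le> 1;
        \<And>i. i \<in> IA \<Longrightarrow> \<bar>a i - p i * a i0\<bar> < \<epsilon>; \<And>j. j \<in> JB \<Longrightarrow> \<bar>b j - q j * b j0\<bar> < \<epsilon>;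
        \<And>k. k \<in> KC \<Longrightarrow> \<bar>w0 \<bullet> eC k h0 + c k - \<gamma> (a i0) (b j0) * (w0 \<bullet> eC k h0)\<bar> < \<epsilon>; 0 < \<epsilon>\<rbrakk>
      \<Longrightarrow> \<bar>(w0 \<bullet> eA i h0 + a i) * (w0 \<bullet> eB j h0 + b j) * (w0 \<bullet> eC k h0 + c k)
          - (w0 \<bullet> eA i h0) * (w0 \<bullet> eB j h0) * (w0 \<bullet> eC k h0)\<bar> \<le> Mc * \<epsilon>"
    obtain \<Lambda>p where \<Lambda>p: "1 \<le> \<Lambda>p" "\<And>i. \<bar>p i\<bar> \<le> \<Lambda>p" using finite_family_bound[of p] by blast
    obtain \<Lambda>q where \<Lambda>q: "1 \<le> \<Lambda>q" "\<And>j. \<bar>q j\<bar> \<le> \<Lambda>q" using finite_family_bound[of q] by blast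
    \<comment> \<open>One norm bound for the functionals of all stages:
      \<open>1 + \<Lambda>p\<close> and \<open>1 + \<Lambda>q\<close> serve \<open>V1\<close>,
      \<open>N\<close> serves \<open>V2\<close>, and \<open>CARD('h) * N\<close> serves
      \<open>V3\<close>.\<close>
    define \<Lambda> where "\<Lambda> = 1 + \<Lambda>p + \<Lambda>q + real (CARD('h) + 1) * real N"
    have \<Lambda>: "1 \<le> \<Lambda>" "1 + \<Lambda>p \<le> \<Lambda>" "1 + \<Lambda>q \<le> \<Lambda>" "real N \<le> \<Lambda>" "real CARD('h) * real N \<le> \<Lambda>" "0 \<le> \<Lambda>"
      using \<Lambda>p(1) \<Lambda>q(1) by (simp_all add: \<Lambda>_def algebra_simps add_nonneg_nonneg)
    obtain R1 where R1: "R1 \<subseteq> - S" "card R1 = r" using obtain_subset_with_card_n[OF r(1)] by blast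
    define R2 where "R2 = - S - R1"
    have cardR2: "card R2 = card (- S) - r"
      unfolding R2_def using R1 by (simp add: card_Diff_subset)
    \<comment> \<open>The bound \<open>\<rho> / 2\<close> keeps an exchange with a point of norm
      below \<open>\<rho> / 2\<close> inside the ball of radius \<rho>; the bound
      \<open>\<rho>0\<close> is what the rank-one conditions require.\<close>
    define \<rho>1 where "\<rho>1 = min (\<rho>/2) \<rho>0"
    have \<rho>1: "0 < \<rho>1" "\<rho>1 \<le> \<rho>/2" "\<rho>1 \<le> \<rho>0" using \<rho> \<rho>0 by (auto simp: \<rho>1_def)
    define D2 where "D2 = (\<lambda>(j, h). eB j h) ` (UNIV \<times> R2)"
    define D3 where "D3 = range (\<lambda>(k, h). eC k h)"
    have D2: "D2 \<subseteq> Basis" and D3: "D3 \<subseteq> Basis" using Bas by (auto simp: D2_def D3_def)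
    have inD2: "eB j h \<in> D2 \<longleftrightarrow> h \<in> R2" "eA i h \<notin> D2" for i j h
      using inj(1) disj(1) by (auto simp: D2_def)
    have inD3: "eC k h \<in> D3" "eA i h \<notin> D3" "eB j h \<notin> D3" for i j k h
      using disj by (auto simp: D3_def)
    define Q2 where "Q2 = coord_proj D2"
    define Q3 where "Q3 = coord_proj D3"
    have exch2: "(x - Q2 x + Q2 z) \<bullet> eA i h = x \<bullet> eA i h"
       "(x - Q2 x + Q2 z) \<bullet> eB j h = (if h \<in> R2 then z \<bullet> eB j h else x \<bullet> eB j h)" for x z i j h
      unfolding Q2_def by (simp_all add: coord_exchange_inner[OF D2] Bas inD2)
    have exch3: "(x - Q3 x + Q3 z) \<bullet> eA i h = x \<bullet> eA i h" "(x - Q3 x + Q3 z) \<bullet> eB j h = x \<bullet> eB j h"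
       "(x - Q3 x + Q3 z) \<bullet> eC k h = z \<bullet> eC k h" for x z i j k h
      unfolding Q3_def by (simp_all add: coord_exchange_inner[OF D3] Bas inD3)
    have lin: "linear Q2" "linear Q3" unfolding Q2_def Q3_def by (rule linear_coord_proj)+
    have comp: "\<bar>x \<bullet> e\<bar> \<le> norm x" if "e \<in> Basis" for x e :: 'e
      using Basis_le_norm[OF that] .
    define X where "X y h = (\<chi> i j. (y \<bullet> eA i h) * (y \<bullet> eB j h) :: real^'j^'i)" for y h
    have X: "X y h $ i $ j = (y \<bullet> eA i h) * (y \<bullet> eB j h)" for y h i j
      by (simp add: X_def)
    have Xinner: "u \<bullet> X y h = (\<Sum>(i,j)\<in>UNIV. u $ i $ j * ((y \<bullet> eA i h) * (y \<bullet> eB j h)))" for u y h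
      by (simp add: inner_vec_def X UNIV_Times_UNIV[symmetric] sum.cartesian_product[symmetric] del: UNIV_Times_UNIV)
    have unit: "\<bar>u $ i $ j\<bar> \<le> 1" if "norm u = 1" for u :: "real^'j^'i" and i j
      using order_trans[OF component_le_norm_cart Finite_Cartesian_Product.norm_nth_le, of u i j] that by simp
    have Xbound: "\<bar>u \<bullet> X y h\<bar> \<le> real N" if "norm u = 1" "norm y \<le> 1" for u y h
    proof -
      have "\<bar>u \<bullet> X y h\<bar> \<le> (\<Sum>(i,j)\<in>(UNIV::('i\<times>'j) set). 1)"
        unfolding Xinner
      proof (intro order_trans[OF sum_abs] sum_mono, clarify)
        fix i j
        have "\<bar>u $ i $ j\<bar> * (\<bar>y \<bullet> eA i h\<bar> * \<bar>y \<bullet> eB j h\<bar>) \<le> 1 * (1 * 1)"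
          using unit[OF that(1)] comp[OF Bas(1)[of i h], of y] comp[OF Bas(2)[of j h], of y] that(2)
          by (intro mult_mono) auto
        then show "\<bar>u $ i $ j * ((y \<bullet> eA i h) * (y \<bullet> eB j h))\<bar> \<le> 1" by (simp add: abs_mult)
      qed
      then show ?thesis by (simp add: N_def)
    qed
    define Mtot where "Mtot = Mc + real CARD('h) * (3 * (\<Omega> + 1)\<^sup>2) + real N * (real CARD('h) + 1)"
    have N0: "0 < N" by (simp add: N_def)
    have Mtot: "0 < Mtot"
      unfolding Mtot_def using Mc N0 by (intro add_nonneg_pos add_nonneg_nonneg mult_nonneg_nonneg mult_pos_pos) auto
    define G where "G \<epsilon> = {w. norm w \<le> \<sigma> \<and>
        (\<forall>i j k. \<bar>tensor_entry eA eB eC (w0 + w) i j k - tensor_entry eA eB eC w0 i j k\<bar> \<le> Mtot * \<epsilon>)}" for \<epsilon>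
    have Gbor: "G \<epsilon> \<in> sets borel" for \<epsilon>
    proof -
      have "closed (G \<epsilon>)"
        unfolding G_def by (intro closed_Collect_conj closed_Collect_all closed_Collect_le continuous_intros)
      then show ?thesis by simp
    qed

    define V1 where "V1 = (\<lambda>(i, h). eA i h) ` (UNIV \<times> (S - {h0})) \<union> (\<lambda>(j, h). eB j h) ` (UNIV \<times> (S - {h0}))
        \<union> (\<lambda>i. eA i h0 - p i *\<^sub>R eA i0 h0) ` IA \<union> (\<lambda>j. eB j h0 - q j *\<^sub>R eB j0 h0) ` JB"
    define n1 where "n1 = (CARD('i) + CARD('j)) * (card S - 1) + card IA + card JB"
    have V1fin: "finite V1" by (simp add: V1_def)
    have V1card: "card V1 \<le> n1"
    proof -
      have "card V1 \<le> card ((UNIV::'i set) \<times> (S - {h0})) + card ((UNIV::'j set) \<times> (S - {h0})) + card IA + card JB"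
        unfolding V1_def
        by (intro order_trans[OF card_Un_le] add_mono card_image_le) auto
      also have "\<dots> = n1" using h0 by (simp add: n1_def card_cartesian_product algebra_simps)
      finally show ?thesis .
    qed
    have V1norm: "norm v \<le> \<Lambda>" if "v \<in> V1" for v
    proof -
      have "norm (eA i h0 - p i *\<^sub>R eA i0 h0) \<le> \<Lambda>" for i
        using norm_triangle_ineq4[of "eA i h0" "p i *\<^sub>R eA i0 h0"] Bas(1) \<Lambda>p(2)[of i] \<Lambda>(2) by simp
      moreover have "norm (eB j h0 - q j *\<^sub>R eB j0 h0) \<le> \<Lambda>" for j
        using norm_triangle_ineq4[of "eB j h0" "q j *\<^sub>R eB j0 h0"] Bas(2) \<Lambda>q(2)[of j] \<Lambda>(3) by simp
      ultimately show ?thesis using that \<Lambda>(1) Bas by (auto simp: V1_def)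
    qed

    \<comment> \<open>Pairing such a vector with \<open>z\<close> gives the inner product of
      \<open>u\<close> with the rank-one matrix formed by column \<open>h\<close> of
      \<open>A\<close> taken from \<open>y\<close> and column \<open>h\<close> of \<open>B\<close>
      taken from \<open>z\<close>: a linear functional of the latter.\<close>
    define V2 where "V2 U W y = (\<lambda>(u, h). \<Sum>(i,j)\<in>UNIV. (u $ i $ j * (y \<bullet> eA i h)) *\<^sub>R eB j h) ` ((U - W) \<times> R2)"
      for U W :: "(real^'j^'i) set" and y
    define n2 where "n2 = (N - r) * (card (- S) - r)"
    \<comment> \<open>The last group has one functional for each row \<open>k\<close> of
      \<open>C\<close> and each \<open>u\<close> in \<open>W\<close>; it controls the coordinate
      along \<open>u\<close> of slice \<open>k\<close> of the error.\<close>
    define V3 where "V3 W y = (\<lambda>(k, h). eC k h) ` (UNIV \<times> (S - {h0})) \<union> (\<lambda>k. eC k h0) ` KC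
        \<union> (\<lambda>(u, k). \<Sum>h\<in>-S. (u \<bullet> X y h) *\<^sub>R eC k h) ` (W \<times> UNIV)" for W y
    define n3 where "n3 = CARD('k) * (card S - 1) + card KC + r * CARD('k)"

    define \<kappa> where "\<kappa> s m = measure lborel (ball (0::'e) (s/2)) / (\<Lambda> * s + 2) ^ m" for s and m :: nat
    have \<kappa>: "0 < \<kappa> s m" if "0 < s" for s m
      using that \<Lambda>(6) unfolding \<kappa>_def
      by (intro divide_pos_pos zero_less_power add_nonneg_pos mult_nonneg_nonneg) (auto simp: content_ball_pos)
    have slab: "ennreal (\<kappa> s m * \<epsilon> ^ m) \<le> emeasure lborel {x\<in>ball 0 s. \<forall>v\<in>V. \<bar>x \<bullet> v\<bar> < \<epsilon>}"
      if "finite V" "card V \<le> m" "\<And>v. v \<in> V \<Longrightarrow> norm v \<le> \<Lambda>" "0 < s" "0 < \<epsilon>" "\<epsilon> \<le> 1"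
      for s m \<epsilon> and V :: "'e set"
      unfolding \<kappa>_def using that \<Lambda>(6) by (intro slab_volume) auto

    \<comment> \<open>The target of stage two: points from which stage three finds a large fibre in
      \<open>G \<epsilon>\<close>. It does not mention \<open>U\<close> or \<open>W\<close>, so no
      regularity of their choice enters its measurability.\<close>
    define G1 where "G1 \<epsilon> = {y\<in>ball 0 \<rho>. ennreal (\<kappa> (\<rho>/2) n3 * \<epsilon> ^ n3) \<le> emeasure lborel {u\<in>ball 0 \<rho>. y - Q3 y + Q3 u \<in> G \<epsilon>}}" for \<epsilon>
    have G1bor: "G1 \<epsilon> \<in> sets borel" for \<epsilon>
      unfolding G1_def by (rule fibre_volume(1)[OF lin(2) Gbor \<rho>(1)])
    have step: "ennreal (\<kappa> (\<rho>/2) n2 * \<epsilon> ^ n2) \<le> emeasure lborel {z\<in>ball 0 (\<rho>/2). x - Q2 x + Q2 z \<in> G1 \<epsilon>}"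
      if \<epsilon>: "0 < \<epsilon>" "\<epsilon> \<le> 1" and x: "x \<in> ball 0 \<rho>1" "\<forall>v\<in>V1. \<bar>x \<bullet> v\<bar> < \<epsilon>" for x \<epsilon>
    proof -
      have nx: "norm x < \<rho>1" using x by simp
      have "card (X x ` R1) \<le> r" using card_image_le[of R1 "X x"] R1 by simp
      moreover have "r \<le> DIM(real^'j^'i)" using r(2) by (simp add: mult.commute)
      \<comment> \<open>The basis depends on the point \<open>x\<close> of stage one, through the
        matrices of the \<open>r\<close> columns in \<open>R1\<close>.\<close>
      ultimately obtain U W where U: "finite U" "card U = DIM(real^'j^'i)" "pairwise orthogonal U"
          "\<And>u. u \<in> U \<Longrightarrow> norm u = 1" "span U = UNIV" and W: "W \<subseteq> U" "card W = r"
          and UWX: "\<And>u y. u \<in> U - W \<Longrightarrow> y \<in> X x ` R1 \<Longrightarrow> u \<bullet> y = 0"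
        using orthonormal_basis_adapted[of "X x ` R1" r] by (metis finite finite_imageI)
      have cU: "card U = N" using U(2) by (simp add: N_def)
      have Wfin: "finite W" using W(1) U(1) by (rule finite_subset)
      have "{z\<in>ball 0 (\<rho>/2). \<forall>v\<in>V2 U W x. \<bar>z \<bullet> v\<bar> < \<epsilon>} \<subseteq> {z\<in>ball 0 (\<rho>/2). x - Q2 x + Q2 z \<in> G1 \<epsilon>}"
      proof clarify
        fix z :: 'e assume z: "z \<in> ball 0 (\<rho>/2)" "\<forall>v\<in>V2 U W x. \<bar>z \<bullet> v\<bar> < \<epsilon>"
        define y where "y = x - Q2 x + Q2 z"
        have yA: "y \<bullet> eA i h = x \<bullet> eA i h" for i h by (simp add: y_def exch2)
        have yB: "y \<bullet> eB j h = (if h \<in> R2 then z \<bullet> eB j h else x \<bullet> eB j h)" for j h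
          by (simp add: y_def exch2)
        have ny: "norm y < \<rho>"
          using norm_coord_exchange[OF D2, of x z] z(1) nx \<rho>1(2) by (simp add: y_def Q2_def)
        \<comment> \<open>For columns in \<open>R2\<close> this is the condition of stage two; for
          columns in \<open>R1\<close> the inner product is exactly zero by the choice of
          \<open>U\<close> and \<open>W\<close>.\<close>
        have UW: "\<bar>u \<bullet> X y h\<bar> \<le> \<epsilon>" if "u \<in> U - W" "h \<notin> S" for u h
        proof (cases "h \<in> R2")
          case True
          have "\<bar>z \<bullet> (\<Sum>(i,j)\<in>UNIV. (u $ i $ j * (x \<bullet> eA i h)) *\<^sub>R eB j h)\<bar> < \<epsilon>"
            using z(2) that(1) True unfolding V2_def by fast
          also have "z \<bullet> (\<Sum>(i,j)\<in>UNIV. (u $ i $ j * (x \<bullet> eA i h)) *\<^sub>R eB j h) = u \<bullet> X y h"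
            unfolding Xinner inner_sum_right
            by (intro sum.cong) (auto simp: yA yB True mult_ac)
          finally show ?thesis by simp
        next
          case False
          then have "h \<in> R1" using that(2) by (auto simp: R2_def)
          moreover have "X y h = X x h" by (simp add: vec_eq_iff X yA yB False)
          ultimately show ?thesis using UWX[OF that(1), of "X x h"] \<epsilon>(1) by simp
        qed
        \<comment> \<open>The conditions on column \<open>h0\<close> of \<open>C\<close> are centred
          at the rescaled truth, not at displacement 0. \<open>u0\<close> is this centre, and the
          slab of stage three is translated by it.\<close>
        define u0 where "u0 = (\<Sum>k\<in>UNIV. (\<gamma> (x \<bullet> eA i0 h0) (x \<bullet> eB j0 h0) * (w0 \<bullet> eC k h0) - w0 \<bullet> eC k h0) *\<^sub>R eC k h0)"
        have xsmall: "\<bar>x \<bullet> eA i h\<bar> \<le> \<rho>0" "\<bar>x \<bullet> eB j h\<bar> \<le> \<rho>0" for i j h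
          using comp[OF Bas(1)[of i h], of x] comp[OF Bas(2)[of j h], of x] nx \<rho>1(3) by linarith+
        have nu0: "norm u0 \<le> \<rho>/2"
        proof -
          have "norm u0 \<le> real CARD('k) * (\<rho> / (2 * real CARD('k)))"
            unfolding u0_def using \<gamma>[OF xsmall(1) xsmall(2)] by (intro norm_sum_Basis_le Bas) auto
          then show ?thesis by simp
        qed
        have u0C: "u0 \<bullet> eC k h = (if h = h0 then \<gamma> (x \<bullet> eA i0 h0) (x \<bullet> eB j0 h0) * (w0 \<bullet> eC k h0) - w0 \<bullet> eC k h0 else 0)" for k h
        proof -
          have "u0 \<bullet> eC k h = (\<Sum>k'\<in>UNIV. if k' = k then (if h = h0 then \<gamma> (x \<bullet> eA i0 h0) (x \<bullet> eB j0 h0) * (w0 \<bullet> eC k h0) - w0 \<bullet> eC k h0 else 0) else 0)"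
            unfolding u0_def inner_sum_left
            using inj(2) by (intro sum.cong) (auto simp: inner_Basis Bas)
          then show ?thesis by simp
        qed
        have sub: "{u. u + (- u0) \<in> {u\<in>ball 0 (\<rho>/2). \<forall>v\<in>V3 W y. \<bar>u \<bullet> v\<bar> < \<epsilon>}} \<subseteq> {u\<in>ball 0 \<rho>. y - Q3 y + Q3 u \<in> G \<epsilon>}"
        proof clarify
          fix u :: 'e assume u1: "u + (- u0) \<in> ball 0 (\<rho>/2)" and u2: "\<forall>v\<in>V3 W y. \<bar>(u + (- u0)) \<bullet> v\<bar> < \<epsilon>"
          have nu: "norm u < \<rho>" using norm_triangle_ineq[of "u + (- u0)" u0] u1 nu0 by simp
          define w where "w = y - Q3 y + Q3 u"
          have wA: "w \<bullet> eA i h = y \<bullet> eA i h" and wB: "w \<bullet> eB j h = y \<bullet> eB j h" and wC: "w \<bullet> eC k h = u \<bullet> eC k h"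
            for i j k h by (simp_all add: w_def exch3)
          have nw: "norm w \<le> \<sigma>"
            using norm_coord_exchange[OF D3, of y u] ny nu \<rho>(3) by (simp add: w_def Q3_def)
          have wX: "X w h = X y h" for h by (simp add: vec_eq_iff X wA wB)
          have uC: "\<bar>u \<bullet> eC k h\<bar> \<le> 1" for k h
            using comp[OF Bas(3)[of k h], of u] nu \<rho>(2) by linarith
          have S2: "h \<notin> R2" if "h \<in> S" for h using that by (auto simp: R2_def)
          have near: "\<bar>w \<bullet> eA i h\<bar> < \<epsilon>" "\<bar>w \<bullet> eB j h\<bar> < \<epsilon>" "\<bar>w \<bullet> eC k h\<bar> < \<epsilon>" if "h \<in> S - {h0}" for i j k h
          proof -
            have "eA i h \<in> V1" "eB j h \<in> V1" using that by (auto simp: V1_def image_iff)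
            then show "\<bar>w \<bullet> eA i h\<bar> < \<epsilon>" "\<bar>w \<bullet> eB j h\<bar> < \<epsilon>"
              using x(2) S2 that by (auto simp: wA wB yA yB)
            have "eC k h \<in> V3 W y" using that by (auto simp: V3_def image_iff)
            then have "\<bar>(u + (- u0)) \<bullet> eC k h\<bar> < \<epsilon>" using u2 by blast
            then show "\<bar>w \<bullet> eC k h\<bar> < \<epsilon>" using that by (simp add: wC inner_diff_left u0C)
          qed
          have near0: "\<bar>(w0 \<bullet> eA i h0 + w \<bullet> eA i h0) * (w0 \<bullet> eB j h0 + w \<bullet> eB j h0) * (w0 \<bullet> eC k h0 + w \<bullet> eC k h0)
            - (w0 \<bullet> eA i h0) * (w0 \<bullet> eB j h0) * (w0 \<bullet> eC k h0)\<bar> \<le> Mc * \<epsilon>" for i j k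
          proof (rule col)
            show "\<epsilon> \<le> 1" "0 < \<epsilon>" by fact+
            show "\<bar>w \<bullet> eA i h0\<bar> \<le> \<rho>0" for i using xsmall by (simp add: wA yA)
            show "\<bar>w \<bullet> eB j h0\<bar> \<le> \<rho>0" for j using xsmall S2[OF h0] by (simp add: wB yB)
            show "\<bar>w \<bullet> eC k h0\<bar> \<le> 1" for k using uC by (simp add: wC)
            show "\<bar>w \<bullet> eA i h0 - p i * (w \<bullet> eA i0 h0)\<bar> < \<epsilon>" if "i \<in> IA" for i
            proof -
              have "eA i h0 - p i *\<^sub>R eA i0 h0 \<in> V1" using that by (auto simp: V1_def)
              then have "\<bar>x \<bullet> (eA i h0 - p i *\<^sub>R eA i0 h0)\<bar> < \<epsilon>" using x(2) by blast
              then show ?thesis by (simp add: wA yA inner_diff_right)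
            qed
            show "\<bar>w \<bullet> eB j h0 - q j * (w \<bullet> eB j0 h0)\<bar> < \<epsilon>" if "j \<in> JB" for j
            proof -
              have "eB j h0 - q j *\<^sub>R eB j0 h0 \<in> V1" using that by (auto simp: V1_def)
              then have "\<bar>x \<bullet> (eB j h0 - q j *\<^sub>R eB j0 h0)\<bar> < \<epsilon>" using x(2) by blast
              then show ?thesis using S2[OF h0] by (simp add: wB yB inner_diff_right)
            qed
            show "\<bar>w0 \<bullet> eC k h0 + w \<bullet> eC k h0 - \<gamma> (w \<bullet> eA i0 h0) (w \<bullet> eB j0 h0) * (w0 \<bullet> eC k h0)\<bar> < \<epsilon>" if "k \<in> KC" for k
            proof -
              have "eC k h0 \<in> V3 W y" using that by (auto simp: V3_def)
              then have "\<bar>(u + (- u0)) \<bullet> eC k h0\<bar> < \<epsilon>" using u2 by blast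
              then show ?thesis using S2[OF h0] by (simp add: wA wB wC yA yB inner_diff_left u0C algebra_simps)
            qed
          qed
          have Wsum: "\<bar>\<Sum>h\<in>-S. (v \<bullet> X w h) * (w \<bullet> eC k h)\<bar> \<le> \<epsilon>" if "v \<in> U \<inter> W" for v k
          proof -
            have "(\<Sum>h\<in>-S. (v \<bullet> X y h) *\<^sub>R eC k h) \<in> V3 W y" using that by (auto simp: V3_def image_iff)
            then have "\<bar>(u + (- u0)) \<bullet> (\<Sum>h\<in>-S. (v \<bullet> X y h) *\<^sub>R eC k h)\<bar> < \<epsilon>" using u2 by blast
            \<comment> \<open>\<open>u0\<close> lives on column \<open>h0\<close>, which belongs to
              \<open>S\<close>, so the translation does not affect conditions on columns outside
              \<open>S\<close>.\<close>
            also have "(u + (- u0)) \<bullet> (\<Sum>h\<in>-S. (v \<bullet> X y h) *\<^sub>R eC k h) = (\<Sum>h\<in>-S. (v \<bullet> X w h) * (w \<bullet> eC k h))"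
              unfolding inner_sum_right
              using h0 by (intro sum.cong) (auto simp: wX wC inner_diff_left u0C)
            finally show ?thesis by simp
          qed
          have "\<bar>tensor_entry eA eB eC (w0 + w) i j k - tensor_entry eA eB eC w0 i j k\<bar> \<le> Mtot * \<epsilon>" for i j k
            unfolding tensor_entry_def inner_add_left Mtot_def
            by (rule tensor_estimate[where a = "\<lambda>i h. w \<bullet> eA i h" and b = "\<lambda>j h. w \<bullet> eB j h" and c = "\<lambda>k h. w \<bullet> eC k h"
                  and ?a0.0 = "\<lambda>i h. w0 \<bullet> eA i h" and ?b0.0 = "\<lambda>j h. w0 \<bullet> eB j h" and ?c0.0 = "\<lambda>k h. w0 \<bullet> eC k h"
                  and X = "X w" and U = U and W = W and S = S and ?h0.0 = h0])
               (use h0 \<epsilon> pad near near0 X U cU UW Wsum uC comp Bas in \<open>auto simp: \<Omega>_def wX wA wB wC\<close>)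
          then show "u \<in> ball 0 \<rho> \<and> y - Q3 y + Q3 u \<in> G \<epsilon>"
            using nu nw by (simp add: G_def w_def[symmetric])
        qed
        have "ennreal (\<kappa> (\<rho>/2) n3 * \<epsilon> ^ n3) \<le> emeasure lborel {u\<in>ball 0 (\<rho>/2). \<forall>v\<in>V3 W y. \<bar>u \<bullet> v\<bar> < \<epsilon>}"
        proof (rule slab)
          show "finite (V3 W y)" using Wfin by (simp add: V3_def)
          have "card (V3 W y) \<le> card ((UNIV::'k set) \<times> (S - {h0})) + card KC + card (W \<times> (UNIV::'k set))"
            unfolding V3_def using Wfin
            by (intro order_trans[OF card_Un_le] add_mono card_image_le) auto
          also have "\<dots> = n3" using h0 W(2) by (simp add: n3_def card_cartesian_product algebra_simps)
          finally show "card (V3 W y) \<le> n3" .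
          show "norm v \<le> \<Lambda>" if "v \<in> V3 W y" for v
          proof -
            have "norm (\<Sum>h\<in>-S. (u \<bullet> X y h) *\<^sub>R eC k h) \<le> \<Lambda>" if "u \<in> W" for u k
            proof -
              have "norm (\<Sum>h\<in>-S. (u \<bullet> X y h) *\<^sub>R eC k h) \<le> real (card (-S)) * real N"
                using U(4)[of u] that W(1) ny \<rho>(2) by (intro norm_sum_Basis_le Bas Xbound) auto
              also have "\<dots> \<le> real CARD('h) * real N"
                by (intro mult_right_mono of_nat_mono card_mono) auto
              finally show ?thesis using \<Lambda>(5) by simp
            qed
            then show ?thesis using that \<Lambda>(1) Bas by (auto simp: V3_def)
          qed
        qed (use \<rho> \<epsilon> in auto)
        also have "\<dots> = emeasure lborel {u. u + (- u0) \<in> {u\<in>ball 0 (\<rho>/2). \<forall>v\<in>V3 W y. \<bar>u \<bullet> v\<bar> < \<epsilon>}}"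
          using Wfin by (intro emeasure_lborel_translate[symmetric] slab_measurable) (simp add: V3_def)
        also have "\<dots> \<le> emeasure lborel {u\<in>ball 0 \<rho>. y - Q3 y + Q3 u \<in> G \<epsilon>}"
        proof (rule emeasure_mono[OF sub])
          show "{u\<in>ball 0 \<rho>. y - Q3 y + Q3 u \<in> G \<epsilon>} \<in> sets lborel"
            unfolding sets_lborel by (rule fibre_in_borel[OF lin(2) Gbor])
        qed
        finally show "x - Q2 x + Q2 z \<in> G1 \<epsilon>"
          using ny by (simp add: G1_def y_def)
      qed
      then have mono: "emeasure lborel {z\<in>ball 0 (\<rho>/2). \<forall>v\<in>V2 U W x. \<bar>z \<bullet> v\<bar> < \<epsilon>}
          \<le> emeasure lborel {z\<in>ball 0 (\<rho>/2). x - Q2 x + Q2 z \<in> G1 \<epsilon>}"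
      proof (rule emeasure_mono)
        show "{z\<in>ball 0 (\<rho>/2). x - Q2 x + Q2 z \<in> G1 \<epsilon>} \<in> sets lborel"
          unfolding sets_lborel by (rule fibre_in_borel[OF lin(1) G1bor])
      qed
      have "ennreal (\<kappa> (\<rho>/2) n2 * \<epsilon> ^ n2) \<le> emeasure lborel {z\<in>ball 0 (\<rho>/2). \<forall>v\<in>V2 U W x. \<bar>z \<bullet> v\<bar> < \<epsilon>}"
      proof (rule slab)
        show "finite (V2 U W x)" using U(1) by (simp add: V2_def)
        have "card (V2 U W x) \<le> card ((U - W) \<times> R2)"
          unfolding V2_def using U(1) by (intro card_image_le) auto
        also have "\<dots> = n2" using W Wfin cU cardR2 by (simp add: n2_def card_cartesian_product card_Diff_subset)
        finally show "card (V2 U W x) \<le> n2" .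
        show "norm v \<le> \<Lambda>" if "v \<in> V2 U W x" for v
        proof -
          from that obtain u h where u: "u \<in> U" and v: "v = (\<Sum>t\<in>UNIV. (u $ fst t $ snd t * (x \<bullet> eA (fst t) h)) *\<^sub>R eB (snd t) h)"
            by (auto simp: V2_def case_prod_beta)
          have "norm v \<le> real (card (UNIV::('i\<times>'j) set)) * 1"
            unfolding v
          proof (intro norm_sum_Basis_le Bas)
            fix t
            have "\<bar>u $ fst t $ snd t\<bar> * \<bar>x \<bullet> eA (fst t) h\<bar> \<le> 1 * 1"
              using unit[OF U(4)[OF u]] comp[OF Bas(1)[of "fst t" h], of x] nx \<rho>1(2) \<rho>(2) by (intro mult_mono) auto
            then show "\<bar>u $ fst t $ snd t * (x \<bullet> eA (fst t) h)\<bar> \<le> 1" by (simp add: abs_mult)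
          qed
          then show ?thesis using \<Lambda>(4) by (simp add: N_def)
        qed
      qed (use \<rho> \<epsilon> in auto)
      then show ?thesis using mono by (rule order_trans)
    qed
    define vb where "vb s = measure lborel (ball (0::'e) (2 * s))" for s
    have vb: "0 < vb s" if "0 < s" for s using that by (simp add: vb_def content_ball_pos)
    \<comment> \<open>Two uses of \<open>fibre_volume_ge\<close>, one for each exchange of
      coordinates; each divides by the volume of a ball of doubled radius.\<close>
    define c where "c = \<kappa> (\<rho>/2) n3 * (\<kappa> (\<rho>/2) n2 * \<kappa> \<rho>1 n1 / vb (\<rho>/2)) / vb \<rho>"
    have "0 < c" unfolding c_def using \<kappa> vb \<rho> \<rho>1 by simp
    have main: "ennreal (c * \<epsilon> ^ (n1 + n2 + n3)) \<le> emeasure lborel (G \<epsilon>)" if \<epsilon>: "0 < \<epsilon>" "\<epsilon> \<le> 1" for \<epsilon>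
    proof -
      have "ennreal (\<kappa> (\<rho>/2) n2 * \<epsilon> ^ n2 * (\<kappa> \<rho>1 n1 * \<epsilon> ^ n1) / measure lborel (ball (0::'e) (2*(\<rho>/2))))
          \<le> emeasure lborel (G1 \<epsilon>)"
      proof (rule fibre_volume_ge[OF lin(1) G1bor])
        show "ennreal (\<kappa> \<rho>1 n1 * \<epsilon> ^ n1) \<le> emeasure lborel {x\<in>ball 0 \<rho>1. \<forall>v\<in>V1. \<bar>x \<bullet> v\<bar> < \<epsilon>}"
          by (rule slab[OF V1fin V1card V1norm \<rho>1(1) \<epsilon>])
        show "{x\<in>ball 0 \<rho>1. \<forall>v\<in>V1. \<bar>x \<bullet> v\<bar> < \<epsilon>} \<subseteq> ball 0 (\<rho>/2)" using \<rho>1(2) by auto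
        show "0 \<le> \<kappa> \<rho>1 n1 * \<epsilon> ^ n1" "0 \<le> \<kappa> (\<rho>/2) n2 * \<epsilon> ^ n2"
          using \<kappa>[OF \<rho>1(1)] \<kappa>[of "\<rho>/2"] \<rho> \<epsilon> by (simp_all add: less_imp_le)
      qed (use \<rho> step[OF \<epsilon>] in auto)
      then have "ennreal (\<kappa> (\<rho>/2) n3 * \<epsilon> ^ n3 * (\<kappa> (\<rho>/2) n2 * \<epsilon> ^ n2 * (\<kappa> \<rho>1 n1 * \<epsilon> ^ n1) / vb (\<rho>/2)) / vb \<rho>)
          \<le> emeasure lborel (G \<epsilon>)"
        unfolding vb_def
      proof (intro fibre_volume_ge[OF lin(2) Gbor \<rho>(1), of "G1 \<epsilon>"])
        show "0 \<le> \<kappa> (\<rho>/2) n3 * \<epsilon> ^ n3" using \<kappa>[of "\<rho>/2"] \<rho> \<epsilon> by (simp add: less_imp_le)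
        show "0 \<le> \<kappa> (\<rho>/2) n2 * \<epsilon> ^ n2 * (\<kappa> \<rho>1 n1 * \<epsilon> ^ n1) / measure lborel (ball (0::'e) (2 * (\<rho>/2)))"
          using \<kappa>[OF \<rho>1(1)] \<kappa>[of "\<rho>/2"] \<rho> \<epsilon> by (simp add: less_imp_le)
      qed (auto simp: G1_def)
      also have "\<kappa> (\<rho>/2) n3 * \<epsilon> ^ n3 * (\<kappa> (\<rho>/2) n2 * \<epsilon> ^ n2 * (\<kappa> \<rho>1 n1 * \<epsilon> ^ n1) / vb (\<rho>/2)) / vb \<rho> = c * \<epsilon> ^ (n1 + n2 + n3)"
        by (simp add: c_def power_add)
      finally show ?thesis .
    qed
    \<comment> \<open>The saving of 2 in \<open>n\<close> is the one granted by
      \<open>cardc\<close>; the rest is an exact count of conditions.\<close>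
    have nle: "n1 + n2 + n3 \<le> n"
    proof -
      have "0 < card S" using h0 by (auto simp: card_gt_0_iff)
      then obtain s where s: "card S = Suc s" using gr0_implies_Suc by blast
      have "n1 + n2 + n3 = (CARD('i) + CARD('j)) * s + card IA + card JB + n2 + (CARD('k) * s + card KC + r * CARD('k))"
        by (simp only: n1_def n3_def s diff_Suc_1)
      moreover have "n = ((CARD('i) + CARD('j)) * s + CARD('k) * s + (CARD('i) + CARD('j) + CARD('k))) - 2 + (n2 + r * CARD('k))"
        unfolding n_def n2_def N_def s by (simp add: algebra_simps)
      ultimately show ?thesis using cardc by linarith
    qed
    have "ennreal (c * \<epsilon> ^ n) \<le> emeasure lborel {w. norm w \<le> \<sigma> \<and>
        (\<forall>i j k. \<bar>tensor_entry eA eB eC (w0 + w) i j k - tensor_entry eA eB eC w0 i j k\<bar> \<le> Mtot * \<epsilon>)}"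
      if \<epsilon>: "0 < \<epsilon>" "\<epsilon> \<le> 1" for \<epsilon>
    proof -
      have "c * \<epsilon> ^ n \<le> c * \<epsilon> ^ (n1 + n2 + n3)"
        using \<open>0 < c\<close> \<epsilon> nle by (intro mult_left_mono power_decreasing) auto
      then have "ennreal (c * \<epsilon> ^ n) \<le> ennreal (c * \<epsilon> ^ (n1 + n2 + n3))" by (rule ennreal_leI)
      also have "\<dots> \<le> emeasure lborel (G \<epsilon>)" by (rule main[OF \<epsilon>])
      finally show ?thesis unfolding G_def .
    qed
    then show ?thesis using \<open>0 < c\<close> Mtot by blast
  qed
qed

section \<open>Volume growth bounds the largest pole\<close>

lemma power_div_fact_le_exp:
  fixes x :: real
  assumes "0 \<le> x"
  shows "x ^ n / fact n \<le> exp x"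
proof -
  have s: "(\<lambda>n. x ^ n / fact n) sums exp x"
    using exp_converges[of x] by (simp add: divide_inverse mult.commute)
  have "(\<Sum>i\<in>{n}. x ^ i / fact i) \<le> (\<Sum>n. x ^ n / fact n)"
    using assms by (intro sum_le_suminf sums_summable[OF s]) auto
  then show ?thesis using sums_unique[OF s] by simp
qed

context finite_measure
begin

text \<open>Write the integrand as \<open>exp (- (z - 1) * L x) * exp (- L x)\<close> and expand the
  first factor. Since \<open>L x ^ n / fact n\<close> is at most \<open>exp (L x)\<close>, the terms
  are dominated by the geometric series of \<open>norm (z - 1)\<close>, which is summable and
  integrable against a finite measure.\<close>

lemma laplace_power_series:
  assumes L[measurable]: "L \<in> borel_measurable M" and L0: "\<And>x. 0 \<le> L x"
  defines "a \<equiv> \<lambda>n. \<integral>x. L x ^ n / fact n * exp (- L x) \<partial>M"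
  shows "\<And>n. integrable M (\<lambda>x. L x ^ n / fact n * exp (- L x))"
    and "\<And>z. norm (z - 1) < 1 \<Longrightarrow> (\<lambda>n. complex_of_real ((-1) ^ n * a n) * (z - 1) ^ n) sums
      (\<integral>x. exp (- z * complex_of_real (L x)) \<partial>M)"
proof -
  have b: "0 \<le> L x ^ n / fact n * exp (- L x)" "L x ^ n / fact n * exp (- L x) \<le> 1" for n x
  proof -
    have "L x ^ n / fact n * exp (- L x) \<le> exp (L x) * exp (- L x)"
      by (intro mult_right_mono power_div_fact_le_exp L0) auto
    then show "L x ^ n / fact n * exp (- L x) \<le> 1" by (simp add: exp_minus)
  qed (use L0 in auto)
  show int: "integrable M (\<lambda>x. L x ^ n / fact n * exp (- L x))" for n
  proof (rule integrable_const_bound[of _ 1])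
    show "AE x in M. norm (L x ^ n / fact n * exp (- L x)) \<le> 1"
      using b[of _ n] by (intro AE_I2) (simp only: real_norm_def abs_of_nonneg)
  qed measurable
  fix z :: complex assume z: "norm (z - 1) < 1"
  define f where "f n x = complex_of_real ((-1) ^ n * (L x ^ n / fact n * exp (- L x))) * (z - 1) ^ n" for n x
  have fint: "integrable M (f n)" for n
    unfolding f_def using int[of n]
    by (intro integrable_mult_left integrable_of_real integrable_mult_right) auto
  have nf: "norm (f n x) \<le> norm (z - 1) ^ n" for n x
  proof -
    have "norm (f n x) = (L x ^ n / fact n * exp (- L x)) * norm (z - 1) ^ n"
      unfolding f_def norm_mult norm_of_real norm_power abs_mult[of "(-1) ^ n"] power_abs
      using abs_of_nonneg[OF b(1)[of x n]] by simp
    also have "\<dots> \<le> 1 * norm (z - 1) ^ n" by (intro mult_right_mono b) auto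
    finally show ?thesis by simp
  qed
  have fs: "(\<lambda>n. f n x) sums exp (- z * complex_of_real (L x))" for x
  proof -
    have "(\<lambda>n. (- (z - 1) * complex_of_real (L x)) ^ n /\<^sub>R fact n * exp (- complex_of_real (L x)))
        sums (exp (- (z - 1) * complex_of_real (L x)) * exp (- complex_of_real (L x)))"
      by (intro sums_mult2 exp_converges)
    also have "exp (- (z - 1) * complex_of_real (L x)) * exp (- complex_of_real (L x)) = exp (- z * complex_of_real (L x))"
      by (simp add: exp_add[symmetric] algebra_simps)
    also have "(\<lambda>n. (- (z - 1) * complex_of_real (L x)) ^ n /\<^sub>R fact n * exp (- complex_of_real (L x))) = (\<lambda>n. f n x)"
    proof
      fix n
      have "(- (z - 1) * complex_of_real (L x)) ^ n = (-1) ^ n * (z - 1) ^ n * complex_of_real (L x) ^ n"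
        by (metis mult_minus1 power_mult_distrib)
      then show "(- (z - 1) * complex_of_real (L x)) ^ n /\<^sub>R fact n * exp (- complex_of_real (L x)) = f n x"
        by (simp add: f_def scaleR_conv_of_real exp_of_real[symmetric] divide_inverse)
    qed
    finally show ?thesis .
  qed
  have "(\<lambda>n. integral\<^sup>L M (f n)) sums (\<integral>x. (\<Sum>n. f n x) \<partial>M)"
  proof (rule sums_integral[OF fint])
    have geo: "summable (\<lambda>n. norm (z - 1) ^ n)" using z by (simp add: summable_geometric)
    then show "AE x in M. summable (\<lambda>n. norm (f n x))"
      using nf by (intro AE_I2 summable_comparison_test'[OF geo]) auto
    have "(\<integral>x. norm (f n x) \<partial>M) \<le> (\<integral>x. norm (z - 1) ^ n \<partial>M)" for n
      using fint nf by (intro integral_mono) auto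
    then have "(\<integral>x. norm (f n x) \<partial>M) \<le> measure M (space M) * norm (z - 1) ^ n" for n
      by simp
    then show "summable (\<lambda>n. \<integral>x. norm (f n x) \<partial>M)"
      by (intro summable_comparison_test'[OF summable_mult[OF geo, of "measure M (space M)"], of 0]) auto
  qed
  moreover have "integral\<^sup>L M (f n) = complex_of_real ((-1) ^ n * a n) * (z - 1) ^ n" for n
    unfolding f_def a_def using int[of n]
    by (subst integral_mult_left_zero) (simp add: integral_complex_of_real[symmetric] del: integral_complex_of_real)
  moreover have "(\<Sum>n. f n x) = exp (- z * complex_of_real (L x))" for x
    using fs by (rule sums_unique[symmetric])
  ultimately show "(\<lambda>n. complex_of_real ((-1) ^ n * a n) * (z - 1) ^ n) sums
      (\<integral>x. exp (- z * complex_of_real (L x)) \<partial>M)" by simp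
qed

text \<open>Landau's argument: expanded at \<open>1\<close>, the Laplace transform of a positive measure has Taylor
  coefficients of alternating sign, so where the series converges to the left of \<open>1\<close>, the integral does.\<close>
lemma landau_laplace:
  assumes L[measurable]: "L \<in> borel_measurable M" and L0: "\<And>x. 0 \<le> L x"
    and F: "F holomorphic_on ball 1 R"
    and FL: "\<And>z. norm (z - 1) < 1 \<Longrightarrow> F z = (\<integral>x. exp (- z * complex_of_real (L x)) \<partial>M)"
    and t: "0 \<le> t" "t < R"
  shows "(\<integral>\<^sup>+x. ennreal (exp ((t - 1) * L x)) \<partial>M) < \<infinity>"
proof -
  define a where "a n = (\<integral>x. L x ^ n / fact n * exp (- L x) \<partial>M)" for n
  note PS = laplace_power_series[OF L L0, folded a_def]
  define A where "A = Abs_fps (\<lambda>n. complex_of_real ((-1) ^ n * a n))"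
  have "(\<lambda>u. F (1 + u)) has_fps_expansion A"
  proof (rule has_fps_expansionI)
    have "eventually (\<lambda>u::complex. u \<in> ball 0 1) (nhds 0)"
      by (intro eventually_nhds_in_open) auto
    then show "eventually (\<lambda>u. (\<lambda>n. fps_nth A n * u ^ n) sums F (1 + u)) (nhds 0)"
    proof eventually_elim
      case (elim u)
      then show ?case using PS(2)[of "1 + u"] FL[of "1 + u"] by (simp add: A_def)
    qed
  qed
  moreover have "(\<lambda>u. F (1 + u)) holomorphic_on eball 0 (ereal R)"
  proof -
    have "(F \<circ> (\<lambda>u. 1 + u)) holomorphic_on ball 0 R"
      by (intro holomorphic_on_compose_gen[OF _ F] holomorphic_intros) (auto simp: dist_norm)
    then show ?thesis by (simp add: o_def)
  qed
  \<comment> \<open>The Taylor series about 1 converges in the whole disc where \<open>F\<close> is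
    holomorphic, in particular at \<open>1 - t\<close>, which may lie outside the disc where
    \<open>F\<close> is known to be the integral.\<close>
  ultimately have "(\<lambda>n. fps_nth A n * complex_of_real (- t) ^ n) sums F (1 + complex_of_real (- t))"
    using t by (intro has_fps_expansion_imp_sums_complex[where r = "ereal R"]) auto
  then have "summable (\<lambda>n. fps_nth A n * complex_of_real (- t) ^ n)" by (rule sums_summable)
  also have "(\<lambda>n. fps_nth A n * complex_of_real (- t) ^ n) = (\<lambda>n. complex_of_real (a n * t ^ n))"
  proof
    fix n
    have "(-1) ^ n * a n * (- t) ^ n = a n * ((-1) * (- t)) ^ n"
      by (simp only: power_mult_distrib mult.left_commute mult.assoc)
    then have "(-1) ^ n * a n * (- t) ^ n = a n * t ^ n" by (simp only: mult_minus1 minus_minus)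
    moreover have "fps_nth A n * complex_of_real (- t) ^ n = complex_of_real ((-1) ^ n * a n * (- t) ^ n)"
      by (simp add: A_def)
    ultimately show "fps_nth A n * complex_of_real (- t) ^ n = complex_of_real (a n * t ^ n)" by (simp only:)
  qed
  finally have sum: "summable (\<lambda>n. a n * t ^ n)" by (simp only: summable_complex_of_real)
  have a0: "0 \<le> a n" for n unfolding a_def using L0 by (intro Bochner_Integration.integral_nonneg) auto
  \<comment> \<open>At \<open>1 - t\<close> the alternating signs cancel and all terms are
    nonnegative, so sum and integral commute before the integral is known to be finite.\<close>
  have "(\<integral>\<^sup>+x. ennreal (exp ((t - 1) * L x)) \<partial>M) = (\<integral>\<^sup>+x. (\<Sum>n. ennreal (L x ^ n / fact n * exp (- L x) * t ^ n)) \<partial>M)"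
  proof (intro nn_integral_cong)
    fix x
    have "(\<lambda>n. (t * L x) ^ n /\<^sub>R fact n * exp (- L x)) sums (exp (t * L x) * exp (- L x))"
      by (intro sums_mult2 exp_converges)
    also have "exp (t * L x) * exp (- L x) = exp ((t - 1) * L x)"
      by (simp add: exp_add[symmetric] algebra_simps)
    also have "(\<lambda>n. (t * L x) ^ n /\<^sub>R fact n * exp (- L x)) = (\<lambda>n. L x ^ n / fact n * exp (- L x) * t ^ n)"
      by (auto simp: power_mult_distrib divide_inverse)
    finally have s: "(\<lambda>n. L x ^ n / fact n * exp (- L x) * t ^ n) sums exp ((t - 1) * L x)" .
    show "ennreal (exp ((t - 1) * L x)) = (\<Sum>n. ennreal (L x ^ n / fact n * exp (- L x) * t ^ n))"
      using s t L0 by (subst suminf_ennreal2) (auto simp: sums_unique[symmetric] sums_summable)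
  qed
  also have "\<dots> = (\<Sum>n. \<integral>\<^sup>+x. ennreal (L x ^ n / fact n * exp (- L x) * t ^ n) \<partial>M)"
    by (rule nn_integral_suminf) measurable
  also have "\<dots> = (\<Sum>n. ennreal (a n * t ^ n))"
  proof (intro suminf_cong)
    fix n
    have "(\<integral>\<^sup>+x. ennreal (L x ^ n / fact n * exp (- L x) * t ^ n) \<partial>M) = ennreal (\<integral>x. L x ^ n / fact n * exp (- L x) * t ^ n \<partial>M)"
      using PS(1)[of n] L0 t by (intro nn_integral_eq_integral integrable_mult_left) auto
    then show "(\<integral>\<^sup>+x. ennreal (L x ^ n / fact n * exp (- L x) * t ^ n) \<partial>M) = ennreal (a n * t ^ n)"
      by (simp add: a_def)
  qed
  also have "\<dots> = ennreal (\<Sum>n. a n * t ^ n)"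
    using sum a0 t by (intro suminf_ennreal2) auto
  also have "\<dots> < \<infinity>" by simp
  finally show ?thesis .
qed

lemma laplace_holomorphic:
  assumes "L \<in> borel_measurable M" "\<And>x. 0 \<le> L x"
  shows "(\<lambda>z. \<integral>x. exp (- z * complex_of_real (L x)) \<partial>M) holomorphic_on ball 1 1"
  by (rule power_series_holomorphic, rule laplace_power_series(2)[OF assms])
     (simp add: dist_norm norm_minus_commute)

end

text \<open>For \<open>s\<close> strictly between \<open>n / 2\<close> and \<open>lam\<close>, the
  finite integral of the power \<open>- s\<close> of \<open>K\<close> exceeds its part over the
  sublevel set at \<open>M' * \<epsilon>\<^sup>2\<close>. That part is at least a constant times
  \<open>\<epsilon> powr (n - 2 * s)\<close>, which is unbounded as \<epsilon> tends to 0.\<close>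

lemma rlct_le_volume_exponent:
  fixes K \<phi> :: "'a::euclidean_space \<Rightarrow> real"
  assumes K[measurable]: "K \<in> borel_measurable borel" and K0: "\<And>w. 0 \<le> K w"
    and \<phi>[measurable]: "\<phi> \<in> borel_measurable borel" and \<phi>0: "\<And>w. 0 \<le> \<phi> w" and \<phi>B: "\<And>w. \<phi> w \<le> B"
    and supp: "\<And>w. \<phi> w \<noteq> 0 \<Longrightarrow> norm w < R \<and> K w \<le> M" and M: "0 < M"
    and null: "AE w in lborel. K w \<noteq> 0"
    and vol: "0 < c" "0 < c'" "0 < M'" "\<And>\<epsilon>. 0 < \<epsilon> \<Longrightarrow> \<epsilon> \<le> 1 \<Longrightarrow>
      ennreal (c * \<epsilon> ^ n) \<le> emeasure lborel {w. K w \<le> M' * \<epsilon>\<^sup>2 \<and> c' \<le> \<phi> w}"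
    and rlct: "is_rlct K \<phi> lam"
  shows "lam \<le> real n / 2"
proof (rule ccontr)
  assume "\<not> lam \<le> real n / 2"
  then have lam: "real n / 2 < lam" by simp
  then obtain s where s: "real n / 2 < s" "s < lam" using dense by blast
  have s0: "0 < s" using s(1) by (rule le_less_trans[rotated]) simp
  have lam0: "0 < lam" using s s0 by simp
  define \<mu> where "\<mu> = density lborel (\<lambda>w. ennreal (\<phi> w))"
  have [simp]: "sets \<mu> = sets borel" "space \<mu> = UNIV" by (simp_all add: \<mu>_def)
  have B0: "0 \<le> B" using order_trans[OF \<phi>0 \<phi>B] .
  interpret finite_measure \<mu>
  proof
    have "emeasure \<mu> (space \<mu>) = (\<integral>\<^sup>+w. ennreal (\<phi> w) \<partial>lborel)"
      by (simp add: \<mu>_def emeasure_density)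
    also have "\<dots> \<le> (\<integral>\<^sup>+w. ennreal B * indicator (ball (0::'a) R) w \<partial>lborel)"
    proof (intro nn_integral_mono)
      fix w
      have "\<phi> w = 0" if "\<not> norm w < R" using supp that by blast
      then show "ennreal (\<phi> w) \<le> ennreal B * indicator (ball 0 R) w"
        using \<phi>B by (auto split: split_indicator intro!: ennreal_leI)
    qed
    also have "\<dots> = ennreal B * emeasure lborel (ball (0::'a) R)"
      by (simp add: nn_integral_cmult_indicator)
    also have "\<dots> < \<infinity>" using emeasure_lborel_ball_finite[of "0::'a" R]
      by (simp add: ennreal_mult_less_top less_top)
    finally show "emeasure \<mu> (space \<mu>) \<noteq> \<infinity>" by simp
  qed
  \<comment> \<open>Up to a null set of \<open>\<mu>\<close>, \<open>L\<close> is the logarithm of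
    \<open>M / K\<close>. Dividing by the bound \<open>M\<close> makes it nonnegative, and the
    default 0 keeps it so everywhere; the price is the factor \<open>exp (z * ln M)\<close> in the
    zeta function.\<close>
  define L where "L w = (if 0 < K w \<and> K w \<le> M then ln M - ln (K w) else 0)" for w
  have Lm: "L \<in> borel_measurable \<mu>"
  proof -
    have "L \<in> borel_measurable borel" unfolding L_def by measurable
    then show ?thesis by (simp cong: measurable_cong_sets)
  qed
  have L0: "0 \<le> L w" for w by (auto simp: L_def)
  have AEK: "AE w in \<mu>. 0 < K w \<and> K w \<le> M"
  proof -
    have "AE w in lborel. 0 < ennreal (\<phi> w) \<longrightarrow> 0 < K w \<and> K w \<le> M"
      using null
    proof eventually_elim
      case (elim w)
      then show ?case using K0[of w] supp[of w] by auto
    qed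
    then show ?thesis unfolding \<mu>_def by (subst AE_density) auto
  qed
  have zeta: "zeta_fun K \<phi> z = exp (z * complex_of_real (ln M)) * (\<integral>w. exp (- z * complex_of_real (L w)) \<partial>\<mu>)" for z
  proof -
    have "zeta_fun K \<phi> z = (\<integral>w. complex_of_real (K w) powr z \<partial>\<mu>)"
      unfolding zeta_fun_def \<mu>_def
      by (subst integral_density) (auto simp: \<phi>0 scaleR_conv_of_real mult.commute)
    also have "\<dots> = (\<integral>w. exp (z * complex_of_real (ln M)) * exp (- z * complex_of_real (L w)) \<partial>\<mu>)"
    proof (rule integral_cong_AE)
      show "(\<lambda>w. complex_of_real (K w) powr z) \<in> borel_measurable \<mu>"
      proof -
        have "(\<lambda>w. complex_of_real (K w) powr z) \<in> borel_measurable borel" by measurable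
        then show ?thesis by (simp cong: measurable_cong_sets)
      qed
      show "(\<lambda>w. exp (z * complex_of_real (ln M)) * exp (- z * complex_of_real (L w))) \<in> borel_measurable \<mu>"
        using Lm by measurable
      show "AE w in \<mu>. complex_of_real (K w) powr z = exp (z * complex_of_real (ln M)) * exp (- z * complex_of_real (L w))"
        using AEK
      proof eventually_elim
        case (elim w)
        then show ?case
          by (simp add: powr_def L_def Ln_of_real exp_add[symmetric] algebra_simps)
      qed
    qed
    also have "\<dots> = exp (z * complex_of_real (ln M)) * (\<integral>w. exp (- z * complex_of_real (L w)) \<partial>\<mu>)"
      by (rule integral_mult_right_zero)
    finally show ?thesis .
  qed
  from rlct obtain f where f: "f meromorphic_on UNIV" "\<And>z. Re z > 0 \<Longrightarrow> f z = zeta_fun K \<phi> z"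
    "\<And>p. is_pole f p \<Longrightarrow> Re p \<le> - lam" unfolding is_rlct_def by blast
  have ball1: "Re z > 0" if "z \<in> ball 1 1" for z
    using that abs_Re_le_cmod[of "1 - z"] by (simp add: dist_norm)
  \<comment> \<open>\<open>f\<close> may take arbitrary values at removable singularities, so the
    continuation is read from \<open>remove_sings f\<close>; the exponential undoes the factor
    coming from \<open>M\<close>.\<close>
  define F where "F z = exp (- z * complex_of_real (ln M)) * remove_sings f z" for z
  \<comment> \<open>The ball lies in the half-plane \<open>Re z > - lam\<close>, where
    \<open>f\<close> has no pole.\<close>
  have "remove_sings f holomorphic_on ball 1 (1 + lam)"
  proof -
    have "remove_sings f analytic_on {z}" if "z \<in> ball 1 (1 + lam)" for z
    proof -
      have "- lam < Re z" using that abs_Re_le_cmod[of "1 - z"] by (simp add: dist_norm)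
      then have np: "\<not> is_pole f z" using f(3)[of z] by auto
      have "f meromorphic_on {z}" using f(1) by (rule meromorphic_on_subset) auto
      then have "isolated_singularity_at f z" "not_essential f z" by (simp_all add: meromorphic_at_iff)
      then show ?thesis using np unfolding not_essential_def by (auto intro: remove_sings_analytic_at)
    qed
    then show ?thesis by (meson analytic_imp_holomorphic analytic_on_analytic_at)
  qed
  then have Fhol: "F holomorphic_on ball 1 (1 + lam)"
    unfolding F_def by (intro holomorphic_intros)
  have FL: "F z = (\<integral>w. exp (- z * complex_of_real (L w)) \<partial>\<mu>)" if "norm (z - 1) < 1" for z
  proof -
    have z: "z \<in> ball 1 1" using that by (simp add: dist_norm norm_minus_commute)
    have "(\<lambda>z. exp (z * complex_of_real (ln M)) * (\<integral>w. exp (- z * complex_of_real (L w)) \<partial>\<mu>)) holomorphic_on ball 1 1"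
      by (intro holomorphic_intros laplace_holomorphic Lm L0)
    then have "f holomorphic_on ball 1 1"
      by (rule holomorphic_transform) (simp add: f(2) ball1 zeta)
    then have "f analytic_on {z}" using z by (intro holomorphic_on_imp_analytic_at) auto
    then have "remove_sings f z = exp (z * complex_of_real (ln M)) * (\<integral>w. exp (- z * complex_of_real (L w)) \<partial>\<mu>)"
      using z by (simp add: f(2) ball1 zeta)
    then show ?thesis by (simp add: F_def exp_add[symmetric] mult.assoc[symmetric])
  qed
  have fin: "(\<integral>\<^sup>+w. ennreal (exp (s * L w)) \<partial>\<mu>) < \<infinity>"
    using landau_laplace[OF Lm L0 Fhol FL, of "1 + s"] s s0 by simp
  then obtain I where I: "(\<integral>\<^sup>+w. ennreal (exp (s * L w)) \<partial>\<mu>) = ennreal I" "0 \<le> I"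
    by (cases "\<integral>\<^sup>+w. ennreal (exp (s * L w)) \<partial>\<mu>") auto
  have bound: "c' * (M / (M' * \<epsilon>\<^sup>2)) powr s * (c * \<epsilon> ^ n) \<le> I" if \<epsilon>: "0 < \<epsilon>" "\<epsilon> \<le> 1" for \<epsilon>
  proof -
    define T where "T = {w. K w \<le> M' * \<epsilon>\<^sup>2 \<and> c' \<le> \<phi> w}"
    have [measurable]: "T \<in> sets borel" unfolding T_def by measurable
    let ?q = "c' * (M / (M' * \<epsilon>\<^sup>2)) powr s"
    have q0: "0 \<le> ?q" using vol by simp
    have "ennreal (?q * (c * \<epsilon> ^ n)) \<le> ennreal ?q * emeasure lborel T"
      unfolding T_def using vol(4)[OF \<epsilon>] q0 vol(1) \<epsilon> by (auto simp: ennreal_mult intro: mult_left_mono)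
    also have "\<dots> = (\<integral>\<^sup>+w. ennreal ?q * indicator T w \<partial>lborel)"
      by (simp add: nn_integral_cmult_indicator)
    also have "\<dots> \<le> (\<integral>\<^sup>+w. ennreal (\<phi> w) * ennreal (exp (s * L w)) \<partial>lborel)"
    proof (intro nn_integral_mono_AE)
      show "AE w in lborel. ennreal ?q * indicator T w \<le> ennreal (\<phi> w) * ennreal (exp (s * L w))"
        using null
      proof eventually_elim
        case (elim w)
        show ?case
        proof (cases "w \<in> T")
          case True
          then have w: "K w \<le> M' * \<epsilon>\<^sup>2" "c' \<le> \<phi> w" by (auto simp: T_def)
          have Kw: "0 < K w" "K w \<le> M" using elim K0[of w] supp[of w] w(2) vol(2) by auto
          have "(M / (M' * \<epsilon>\<^sup>2)) powr s \<le> (M / K w) powr s"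
            using M vol(3) \<epsilon> Kw w s0 by (intro powr_mono2 divide_left_mono) auto
          also have "\<dots> = exp (s * L w)" using Kw M by (simp add: powr_def L_def ln_div)
          finally have "?q \<le> \<phi> w * exp (s * L w)" using w(2) vol(2) by (intro mult_mono) auto
          then show ?thesis using True \<phi>0[of w] by (simp add: ennreal_mult[symmetric] ennreal_leI)
        qed simp
      qed
    qed
    also have "\<dots> = ennreal I"
      unfolding I(1)[symmetric] \<mu>_def
      using Lm by (subst nn_integral_density) (auto simp: \<mu>_def)
    finally show ?thesis using I(2) by (simp add: ennreal_le_iff mult.assoc)
  qed
  define C where "C = c' * (M / M') powr s * c"
  have C: "0 < C" using vol M by (simp add: C_def)
  have bound2: "C * \<epsilon> powr (real n - 2 * s) \<le> I" if \<epsilon>: "0 < \<epsilon>" "\<epsilon> \<le> 1" for \<epsilon>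
  proof -
    have "(M / (M' * \<epsilon>\<^sup>2)) powr s = (M / M') powr s * \<epsilon> powr (- 2 * s)"
    proof -
      have "M / (M' * \<epsilon>\<^sup>2) = (M / M') * \<epsilon> powr (-2)"
        using \<epsilon> by (simp add: powr_minus powr_numeral divide_inverse)
      also have "\<dots> powr s = (M / M') powr s * (\<epsilon> powr (-2)) powr s"
        using M vol by (intro powr_mult) 
      finally show ?thesis by (simp add: powr_powr)
    qed
    moreover have "\<epsilon> ^ n = \<epsilon> powr real n" using \<epsilon> by (simp add: powr_realpow)
    ultimately have "c' * (M / (M' * \<epsilon>\<^sup>2)) powr s * (c * \<epsilon> ^ n) = C * (\<epsilon> powr (- 2 * s) * \<epsilon> powr real n)"
      by (simp add: C_def)
    also have "\<epsilon> powr (- 2 * s) * \<epsilon> powr real n = \<epsilon> powr (real n - 2 * s)"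
      by (simp add: powr_add[symmetric])
    finally show ?thesis using bound[OF \<epsilon>] by simp
  qed
  define d where "d = 2 * s - real n"
  have d: "0 < d" using s(1) by (simp add: d_def)
  \<comment> \<open>\<open>x\<close> is chosen so that \<open>C * x\<close> exceeds
    \<open>I\<close>, and \<epsilon> below so that \<open>\<epsilon> powr (n - 2 * s)\<close> equals
    \<open>x\<close>; \<open>1 \<le> x\<close> ensures \<open>\<epsilon> \<le> 1\<close>.\<close>
  define x where "x = (I + C) / C + 1"
  have x: "1 \<le> x" "I < C * x" using I(2) C by (simp_all add: x_def field_simps)
  define \<epsilon> where "\<epsilon> = x powr (- 1 / d)"
  have "0 < \<epsilon>" using x by (simp add: \<epsilon>_def)
  moreover have "\<epsilon> \<le> 1"
    using powr_mono[of "- 1 / d" 0 x] x(1) d by (simp add: \<epsilon>_def)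
  moreover have "\<epsilon> powr (real n - 2 * s) = x"
  proof -
    have "(- 1 / d) * (real n - 2 * s) = 1" using d by (simp add: d_def field_simps)
    then show ?thesis using x unfolding \<epsilon>_def powr_powr by simp
  qed
  ultimately show False using bound2[of \<epsilon>] x(2) by simp
qed

section \<open>Negligibility of the zero set\<close>

lemma hyperplane_null_lborel:
  fixes e :: "'a::euclidean_space"
  assumes "e \<noteq> 0"
  shows "emeasure lborel {x. e \<bullet> x = b} = 0"
proof -
  have "{x. e \<bullet> x = b} \<in> null_sets (completion lborel)"
    using negligible_hyperplane[of e b] assms by (simp add: negligible_iff_null_sets)
  moreover have "{x. e \<bullet> x = b} \<in> sets lborel"
    using closed_hyperplane[of e b] by simp
  ultimately show ?thesis by (simp add: null_sets_completion_iff null_setsD1)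
qed

text \<open>The entry is affine in the coordinate along \<open>eC k h\<close>, with slope the
  product of the coordinates along \<open>eA i h\<close> and \<open>eB j h\<close>. Off the two
  hyperplanes where the slope vanishes, a line in this direction meets the level set at most once,
  so the fibres lie in hyperplanes and \<open>shear_fubini\<close> makes the level set null.\<close>

lemma AE_tensor_entry_neq:
  fixes eA :: "'i \<Rightarrow> 'h::finite \<Rightarrow> 'e::euclidean_space"
  assumes Bas: "eA i h \<in> Basis" "eB j h \<in> Basis" "eC k h \<in> Basis"
    and inj: "\<And>h'. eC k h' = eC k h \<Longrightarrow> h' = h" "\<And>h'. eC k h' \<in> Basis"
    and disj: "\<And>h' h. eA i h' \<noteq> eC k h" "\<And>h' h. eB j h' \<noteq> eC k h" "\<And>h. eA i h \<in> Basis" "\<And>h. eB j h \<in> Basis"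
  shows "AE w in lborel. tensor_entry eA eB eC w i j k \<noteq> t"
proof -
  define e where "e = eC k h"
  define Q where "Q y = (y \<bullet> e) *\<^sub>R e" for y
  have linQ: "linear Q" unfolding Q_def
    by (rule linearI) (simp_all add: inner_add_left scaleR_add_left)
  define G where "G = {w. tensor_entry eA eB eC w i j k = t} - {w. eA i h \<bullet> w = 0} - {w. eB j h \<bullet> w = 0}"
  have cl: "closed {w. tensor_entry eA eB eC w i j k = t}"
    by (intro closed_Collect_eq continuous_intros)
  have Gbor: "G \<in> sets borel"
    unfolding G_def using closed_hyperplane[of "eA i h" 0] closed_hyperplane[of "eB j h" 0] cl by auto
  have shift: "tensor_entry eA eB eC (w + s *\<^sub>R e) i j k
      = tensor_entry eA eB eC w i j k + s * ((w \<bullet> eA i h) * (w \<bullet> eB j h))" for w s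
  proof -
    have eqs: "(w + s *\<^sub>R e) \<bullet> eA i h' = w \<bullet> eA i h'" "(w + s *\<^sub>R e) \<bullet> eB j h' = w \<bullet> eB j h'"
      "(w + s *\<^sub>R e) \<bullet> eC k h' = w \<bullet> eC k h' + (if h' = h then s else 0)" for h'
      using disj(1)[of h' h] disj(2)[of h' h] inj disj(3,4) Bas
      by (auto simp: e_def inner_add_left inner_Basis)
    have "tensor_entry eA eB eC (w + s *\<^sub>R e) i j k
        = (\<Sum>h'\<in>UNIV. (w \<bullet> eA i h') * (w \<bullet> eB j h') * (w \<bullet> eC k h')
            + (if h' = h then s * ((w \<bullet> eA i h) * (w \<bullet> eB j h)) else 0))"
      unfolding tensor_entry_def by (intro sum.cong refl, simp only: eqs, auto simp: algebra_simps)
    then show ?thesis by (simp add: sum.distrib tensor_entry_def)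
  qed
  have "emeasure lborel {y\<in>ball 0 1. x + Q y \<in> G} = 0" for x
  proof (cases "{y\<in>ball 0 1. x + Q y \<in> G} = {}")
    case False
    then obtain y1 where y1: "x + Q y1 \<in> G" by auto
    have pq: "(x + Q y) \<bullet> eA i h = x \<bullet> eA i h" "(x + Q y) \<bullet> eB j h = x \<bullet> eB j h" for y
      using disj(1)[of h h] disj(2)[of h h] Bas by (auto simp: Q_def e_def inner_add_left inner_Basis)
    have sub: "{y\<in>ball 0 1. x + Q y \<in> G} \<subseteq> {y. e \<bullet> y = e \<bullet> y1}"
    proof clarify
      fix y assume "x + Q y \<in> G"
      then have "tensor_entry eA eB eC (x + Q y) i j k = tensor_entry eA eB eC (x + Q y1) i j k"
        "(x \<bullet> eA i h) * (x \<bullet> eB j h) \<noteq> 0"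
        using y1 pq[of y] by (auto simp: G_def inner_commute)
      then show "e \<bullet> y = e \<bullet> y1" unfolding Q_def shift by (simp add: inner_commute)
    qed
    have "e \<noteq> 0" using Bas(3) by (auto simp: e_def)
    have "emeasure lborel {y\<in>ball 0 1. x + Q y \<in> G} \<le> emeasure lborel {y. e \<bullet> y = e \<bullet> y1}"
      by (rule emeasure_mono[OF sub]) (use closed_hyperplane[of e "e \<bullet> y1"] in simp)
    then show ?thesis using hyperplane_null_lborel[OF \<open>e \<noteq> 0\<close>] by simp
  next
    case True
    then show ?thesis by (simp only: emeasure_empty)
  qed
  then have "emeasure lborel G * emeasure lborel (ball (0::'e) 1) = 0"
    using shear_fubini[OF linQ Gbor, of 1] by simp
  moreover have "emeasure lborel (ball (0::'e) 1) \<noteq> 0"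
    using content_ball_pos[of 1 "0::'e"] by (simp add: emeasure_lborel_ball_eq)
  ultimately have "emeasure lborel G = 0" by simp
  then have "AE w in lborel. w \<notin> G" using Gbor by (intro AE_not_in) (auto simp: null_sets_def)
  moreover have "AE w in lborel. \<not> e' \<bullet> w = 0" if "e' \<in> Basis" for e' :: 'e
  proof -
    have "{w. e' \<bullet> w = 0} \<in> null_sets lborel"
      using that nonzero_Basis[OF that] hyperplane_null_lborel[of e' 0] closed_hyperplane[of e' 0] by (auto simp: null_sets_def)
    from AE_not_in[OF this] show ?thesis by simp
  qed
  note this[OF Bas(1)] this[OF Bas(2)]
  ultimately show ?thesis by eventually_elim (simp add: G_def)
qed

text \<open>Joins the volume bound near \<open>w0\<close> to the pole bound. The family in third
  position is the one whose index type stands alone in \<open>Ffun\<close>, so permuting the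
  families yields the other two values.\<close>

lemma rlct_le_codim:
  fixes eA :: "'i::finite \<Rightarrow> 'h::finite \<Rightarrow> 'e::euclidean_space" and eB :: "'j::finite \<Rightarrow> 'h \<Rightarrow> 'e"
    and eC :: "'k::finite \<Rightarrow> 'h \<Rightarrow> 'e" and w0 :: 'e and S :: "'h set" and K \<phi> :: "'e \<Rightarrow> real"
  assumes Bas: "\<And>i h. eA i h \<in> Basis" "\<And>j h. eB j h \<in> Basis" "\<And>k h. eC k h \<in> Basis"
    and inj: "\<And>j h j' h'. eB j h = eB j' h' \<Longrightarrow> j = j' \<and> h = h'"
      "\<And>k h k' h'. eC k h = eC k' h' \<Longrightarrow> k = k' \<and> h = h'"
    and disj: "\<And>i h j h'. eA i h \<noteq> eB j h'" "\<And>i h k h'. eA i h \<noteq> eC k h'" "\<And>j h k h'. eB j h \<noteq> eC k h'"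
    and pad: "\<And>i h. h \<notin> S \<Longrightarrow> w0 \<bullet> eA i h = 0" "\<And>j h. h \<notin> S \<Longrightarrow> w0 \<bullet> eB j h = 0"
      "\<And>k h. h \<notin> S \<Longrightarrow> w0 \<bullet> eC k h = 0"
    and S: "S \<noteq> {}"
    and K: "\<And>w. K w = Z * (\<Sum>i\<in>UNIV. \<Sum>j\<in>UNIV. \<Sum>k\<in>UNIV.
        (tensor_entry eA eB eC w i j k - tensor_entry eA eB eC w0 i j k)\<^sup>2)" and Z: "0 < Z"
    and \<phi>: "\<phi> \<in> borel_measurable borel" "\<And>w. 0 \<le> \<phi> w" "\<And>w. \<phi> w \<le> B" "\<And>w. \<phi> w \<noteq> 0 \<Longrightarrow> norm w < R"
    and \<phi>pos: "0 < e" "0 < c'" "\<And>w. w \<in> ball w0 e \<Longrightarrow> c' \<le> \<phi> w"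
    and rlct: "is_rlct K \<phi> lam"
  shows "lam \<le> (real (card S * (CARD('i) + CARD('j) + CARD('k))) - 2) / 2
    + Ffun (CARD('i) * CARD('j)) CARD('k) (card (- S))"
proof -
  obtain r where r: "r \<le> CARD('i) * CARD('j)" "r \<le> card (- S)"
    and Feq: "Ffun (CARD('i) * CARD('j)) CARD('k) (card (- S))
      = real ((CARD('i) * CARD('j) - r) * (card (- S) - r) + r * CARD('k)) / 2"
    by (rule Ffun_eq_codim)
  define n where "n = card S * (CARD('i) + CARD('j) + CARD('k)) - 2
      + ((CARD('i) * CARD('j) - r) * (card (- S) - r) + r * CARD('k))"
  obtain h0 where h0: "h0 \<in> S" using S by blast
  \<comment> \<open>Half the radius: the closed ball of radius \<open>e / 2\<close> lies in the open
    ball on which \<phi> is bounded below.\<close>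
  have e2: "0 < e / 2" using \<phi>pos(1) by simp
  have "\<exists>c>0. \<exists>M>0. \<forall>\<epsilon>. 0 < \<epsilon> \<longrightarrow> \<epsilon> \<le> 1 \<longrightarrow> ennreal (c * \<epsilon> ^ n) \<le> emeasure lborel {w. norm w \<le> e / 2 \<and>
      (\<forall>i j k. \<bar>tensor_entry eA eB eC (w0 + w) i j k - tensor_entry eA eB eC w0 i j k\<bar> \<le> M * \<epsilon>)}"
    unfolding n_def by (rule tensor_fibre_volume[OF Bas inj disj pad h0 r(2,1) e2])
  then obtain c M where cM: "0 < c" "0 < M" and vol: "\<And>\<epsilon>. 0 < \<epsilon> \<Longrightarrow> \<epsilon> \<le> 1 \<Longrightarrow>
      ennreal (c * \<epsilon> ^ n) \<le> emeasure lborel {w. norm w \<le> e / 2 \<and>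
        (\<forall>i j k. \<bar>tensor_entry eA eB eC (w0 + w) i j k - tensor_entry eA eB eC w0 i j k\<bar> \<le> M * \<epsilon>)}"
    by blast
  have contK: "continuous_on A K" for A
    unfolding K by (intro continuous_intros)
  have K0: "0 \<le> K w" for w unfolding K using Z by (intro mult_nonneg_nonneg sum_nonneg) auto
  obtain MK where MK: "0 < MK" "\<And>w. norm w < R \<Longrightarrow> K w \<le> MK"
  proof -
    have "compact (K ` cball 0 R)" by (intro compact_continuous_image contK compact_cball)
    then have "bounded (K ` cball 0 R)" by (rule compact_imp_bounded)
    then obtain b where "0 < b" "\<forall>x\<in>K ` cball 0 R. norm x \<le> b" by (meson bounded_pos)
    then have "norm (K w) \<le> b" if "norm w < R" for w using that by simp
    then show thesis using \<open>0 < b\<close> by (intro that[of b]) (simp_all add: K0)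
  qed
  \<comment> \<open>One entry differing from the truth already makes the sum of squares
    positive.\<close>
  have null: "AE w in lborel. K w \<noteq> 0"
  proof -
    fix i j k
    have "AE w in lborel. tensor_entry eA eB eC w i j k \<noteq> tensor_entry eA eB eC w0 i j k"
      by (rule AE_tensor_entry_neq[of eA i h0 eB j eC k]) (use Bas inj disj in auto)
    then show ?thesis
    proof eventually_elim
      case (elim w)
      define d where "d i j k = (tensor_entry eA eB eC w i j k - tensor_entry eA eB eC w0 i j k)\<^sup>2" for i j k
      have "0 < d i j k" using elim by (simp add: d_def)
      also have "d i j k \<le> (\<Sum>k\<in>UNIV. d i j k)" by (rule member_le_sum) (auto simp: d_def)
      also have "\<dots> \<le> (\<Sum>j\<in>UNIV. \<Sum>k\<in>UNIV. d i j k)"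
        by (rule member_le_sum[of j UNIV "\<lambda>j. \<Sum>k\<in>UNIV. d i j k"]) (auto simp: d_def intro!: sum_nonneg)
      also have "\<dots> \<le> (\<Sum>i\<in>UNIV. \<Sum>j\<in>UNIV. \<Sum>k\<in>UNIV. d i j k)"
        by (rule member_le_sum[of i UNIV "\<lambda>i. \<Sum>j\<in>UNIV. \<Sum>k\<in>UNIV. d i j k"]) (auto simp: d_def intro!: sum_nonneg)
      finally show ?case using Z by (simp add: K d_def)
    qed
  qed
  \<comment> \<open>If each of the \<open>CARD('i) * CARD('j) * CARD('k)\<close> entries is off by
    at most \<open>M * \<epsilon>\<close>, then \<open>K\<close> is at most
    \<open>M' * \<epsilon>\<^sup>2\<close>.\<close>
  define M' where "M' = Z * (real (CARD('i) * CARD('j) * CARD('k)) * M\<^sup>2)"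
  have M': "0 < M'" using Z cM by (simp add: M'_def)
  have vol': "ennreal (c * \<epsilon> ^ n) \<le> emeasure lborel {w. K w \<le> M' * \<epsilon>\<^sup>2 \<and> c' \<le> \<phi> w}" if \<epsilon>: "0 < \<epsilon>" "\<epsilon> \<le> 1" for \<epsilon>
  proof -
    define A where "A = {w. norm w \<le> e / 2 \<and>
      (\<forall>i j k. \<bar>tensor_entry eA eB eC (w0 + w) i j k - tensor_entry eA eB eC w0 i j k\<bar> \<le> M * \<epsilon>)}"
    have "closed A"
      unfolding A_def by (intro closed_Collect_conj closed_Collect_all closed_Collect_le continuous_intros)
    then have Abor: "A \<in> sets borel" by simp
    have "ennreal (c * \<epsilon> ^ n) \<le> emeasure lborel A" unfolding A_def by (rule vol[OF \<epsilon>])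
    also have "\<dots> = emeasure lborel {w. w + (- w0) \<in> A}"
      by (rule emeasure_lborel_translate[OF Abor, symmetric])
    also have "\<dots> \<le> emeasure lborel {w. K w \<le> M' * \<epsilon>\<^sup>2 \<and> c' \<le> \<phi> w}"
    proof (rule emeasure_mono)
      show "{w. w + (- w0) \<in> A} \<subseteq> {w. K w \<le> M' * \<epsilon>\<^sup>2 \<and> c' \<le> \<phi> w}"
      proof clarify
        fix w assume w: "w + (- w0) \<in> A"
        have "dist w0 w \<le> e / 2" using w by (simp add: A_def dist_norm norm_minus_commute)
        then have "c' \<le> \<phi> w" using \<phi>pos(1) by (intro \<phi>pos(3)) simp
        have "(tensor_entry eA eB eC w i j k - tensor_entry eA eB eC w0 i j k)\<^sup>2 \<le> (M * \<epsilon>)\<^sup>2" for i j k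
        proof -
          have "\<bar>tensor_entry eA eB eC w i j k - tensor_entry eA eB eC w0 i j k\<bar> \<le> M * \<epsilon>"
            using w by (simp add: A_def)
          then show ?thesis using abs_le_square_iff[of _ "M * \<epsilon>"] cM \<epsilon> by simp
        qed
        then have "K w \<le> Z * (\<Sum>i\<in>(UNIV::'i set). \<Sum>j\<in>(UNIV::'j set). \<Sum>k\<in>(UNIV::'k set). (M * \<epsilon>)\<^sup>2)"
          unfolding K using Z by (intro mult_left_mono sum_mono) auto
        also have "\<dots> = M' * \<epsilon>\<^sup>2" by (simp add: M'_def power_mult_distrib)
        finally show "K w \<le> M' * \<epsilon>\<^sup>2 \<and> c' \<le> \<phi> w" using \<open>c' \<le> \<phi> w\<close> by simp
      qed
      have [measurable]: "K \<in> borel_measurable borel" by (rule borel_measurable_continuous_onI[OF contK])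
      note \<phi>(1)[measurable]
      show "{w. K w \<le> M' * \<epsilon>\<^sup>2 \<and> c' \<le> \<phi> w} \<in> sets lborel" by measurable
    qed
    finally show ?thesis .
  qed
  have "lam \<le> real n / 2"
    using borel_measurable_continuous_onI[OF contK] K0 \<phi>(1-3) \<phi>(4) MK null cM(1) \<phi>pos(2) M' vol' rlct
    by (intro rlct_le_volume_exponent[where R = R and M = MK and c' = c' and M' = M' and c = c and B = B and K = K and \<phi> = \<phi>]) auto
  \<comment> \<open>The subtraction of natural numbers in \<open>n\<close> does not truncate,
    because there are at least two conditions to subtract from.\<close>
  moreover have "real (card S * (CARD('i) + CARD('j) + CARD('k)) - 2)
      = real (card S * (CARD('i) + CARD('j) + CARD('k))) - 2"
  proof -
    have "1 \<le> card S" using h0 by (metis One_nat_def Suc_leI card_gt_0_iff emptyE finite)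
    moreover have "1 \<le> CARD('i)" "1 \<le> CARD('j)" by (simp_all add: Suc_leI)
    then have "2 \<le> CARD('i) + CARD('j) + CARD('k)" by linarith
    ultimately have "1 * 2 \<le> card S * (CARD('i) + CARD('j) + CARD('k))" by (rule mult_le_mono)
    then show ?thesis by linarith
  qed
  ultimately show ?thesis unfolding Feq n_def of_nat_add by (simp add: add_divide_distrib)
qed

section \<open>The Gaussian tensor model\<close>

text \<open>The integrand factors over the coordinates, which reduces the claim to the line, where
  it is a multiple of a normal density.\<close>

lemma integrable_exp_neg_norm_sq:
  assumes a: "0 < a"
  shows "integrable lborel (\<lambda>x::'a::euclidean_space. exp (- a * (norm x)\<^sup>2))"
proof -
  have "integrable lborel (\<lambda>t::real. exp (- a * t\<^sup>2))"
  proof -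
    define \<sigma> where "\<sigma> = sqrt (1 / (2 * a))"
    have \<sigma>: "0 < \<sigma>" "\<sigma>\<^sup>2 = 1 / (2 * a)" using a by (simp_all add: \<sigma>_def)
    have "integrable lborel (\<lambda>x. sqrt (2 * pi * \<sigma>\<^sup>2) * (normal_density 0 \<sigma> x * (x - 0) ^ 0))"
      by (intro integrable_mult_right integrable_normal_moment \<sigma>)
    also have "(\<lambda>x. sqrt (2 * pi * \<sigma>\<^sup>2) * (normal_density 0 \<sigma> x * (x - 0) ^ 0)) = (\<lambda>x. exp (- a * x\<^sup>2))"
      using \<sigma> a by (simp add: normal_density_def \<sigma>(2) mult.commute)
    finally show ?thesis .
  qed
  then have "(\<integral>\<^sup>+t. ennreal (exp (- a * t\<^sup>2)) \<partial>lborel) = ennreal (\<integral>t. exp (- a * t\<^sup>2) \<partial>lborel)"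
    by (intro nn_integral_eq_integral) auto
  then obtain I where I: "(\<integral>\<^sup>+t. ennreal (exp (- a * t\<^sup>2)) \<partial>lborel) = ennreal I" "0 \<le> I"
    using Bochner_Integration.integral_nonneg[of lborel "\<lambda>t::real. exp (- a * t\<^sup>2)"] by auto
  have prod: "ennreal (exp (- a * (norm x)\<^sup>2)) = (\<Prod>b\<in>Basis. ennreal (exp (- a * (x \<bullet> b)\<^sup>2)))" for x :: 'a
  proof -
    have "- a * (norm x)\<^sup>2 = (\<Sum>b\<in>Basis. - a * (x \<bullet> b)\<^sup>2)"
      unfolding power2_norm_eq_inner euclidean_inner[of x x] by (simp add: sum_distrib_left power2_eq_square)
    then show ?thesis by (simp add: exp_sum prod_ennreal)
  qed
  have "(\<integral>\<^sup>+x. ennreal (exp (- a * (norm (x::'a))\<^sup>2)) \<partial>lborel) = ennreal (I ^ DIM('a))"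
    unfolding prod by (subst nn_integral_lborel_prod) (auto simp: I[simplified] ennreal_power)
  then show ?thesis by (intro integrableI_nn_integral_finite[where x = "I ^ DIM('a)"]) (use I in auto)
qed

lemma lborel_distr_minus: "distr lborel borel uminus = (lborel :: 'a::euclidean_space measure)"
  using lborel_affine[of "-1" "0::'a"] by (simp add: density_1)

text \<open>The log-ratio of the two densities is the sum of a constant and a linear term, and the
  latter integrates to zero by symmetry; the value of the normalising factor is irrelevant.\<close>
lemma gaussian_KL:
  assumes c: "0 < c"
  obtains Z where "0 < Z" "\<And>T T0 :: 'a::euclidean_space. (\<integral>x. c * exp (- (norm (x - T0))\<^sup>2 / 2) *
      ln (c * exp (- (norm (x - T0))\<^sup>2 / 2) / (c * exp (- (norm (x - T))\<^sup>2 / 2))) \<partial>lborel)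
    = Z * (norm (T - T0))\<^sup>2"
proof -
  define g where "g y = c * exp (- (norm y)\<^sup>2 / 2)" for y :: 'a
  have gint: "integrable lborel g"
    using integrable_exp_neg_norm_sq[of "1/2", where 'a = 'a] unfolding g_def by simp
  \<comment> \<open>The constant part of the log-ratio is \<open>(norm D)\<^sup>2 / 2\<close>, so
    integrating it against \<open>g\<close> produces half the total mass of
    \<open>g\<close>.\<close>
  define Z where "Z = (\<integral>y. g y \<partial>lborel) / 2"
  have Z: "0 < Z"
  proof -
    have "(\<integral>y. indicator (ball (0::'a) 1) y * (c * exp (- 1 / 2)) \<partial>lborel) \<le> (\<integral>y. g y \<partial>lborel)"
    proof (rule integral_mono[OF _ gint])
      show "integrable lborel (\<lambda>y. indicator (ball (0::'a) 1) y * (c * exp (- 1 / 2)))"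
        using emeasure_lborel_ball_finite[of "0::'a" 1]
        by (intro integrable_mult_left integrable_real_indicator) (auto simp: less_top)
      show "indicator (ball (0::'a) 1) y * (c * exp (- 1 / 2)) \<le> g y" for y
      proof (cases "y \<in> ball 0 1")
        case True
        then have "(norm y)\<^sup>2 \<le> 1" using power_le_one[of "norm y" 2] by simp
        then show ?thesis using True c by (simp add: g_def)
      qed (use c in \<open>simp add: g_def\<close>)
    qed
    moreover have "(\<integral>y. indicator (ball (0::'a) 1) y * (c * exp (- 1 / 2)) \<partial>lborel)
        = measure lborel (ball (0::'a) 1) * (c * exp (- 1 / 2))"
      by simp
    moreover have "0 < measure lborel (ball (0::'a) 1) * (c * exp (- 1 / 2))"
      using c by (intro mult_pos_pos) (auto simp: content_ball_pos)
    ultimately show ?thesis by (simp add: Z_def)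
  qed
  have lin: "integrable lborel (\<lambda>y. g y * (y \<bullet> D))" "(\<integral>y. g y * (y \<bullet> D) \<partial>lborel) = 0" for D
  proof -
    have gm: "(\<lambda>y. g y * (y \<bullet> D)) \<in> borel_measurable borel"
      unfolding g_def by (intro borel_measurable_continuous_onI continuous_intros) auto
    \<comment> \<open>Half of the Gaussian exponent is spent on absorbing the linear factor, by
      \<open>norm y \<le> 2 * exp ((norm y)\<^sup>2 / 4)\<close>; the other half keeps the majorant
      integrable.\<close>
    have "integrable lborel (\<lambda>y::'a. 2 * c * norm D * exp (- (1/4) * (norm y)\<^sup>2))"
      by (intro integrable_mult_right integrable_exp_neg_norm_sq) auto
    then show "integrable lborel (\<lambda>y. g y * (y \<bullet> D))"
    proof (rule Bochner_Integration.integrable_bound)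
      show "AE y in lborel. norm (g y * (y \<bullet> D)) \<le> norm (2 * c * norm D * exp (- (1/4) * (norm y)\<^sup>2))"
      proof (intro AE_I2)
        fix y :: 'a
        have "norm y \<le> 2 * (1 + (norm y)\<^sup>2 / 4)"
          using zero_le_power2[of "norm y - 1"] by (simp add: power2_eq_square algebra_simps)
        also have "\<dots> \<le> 2 * exp ((norm y)\<^sup>2 / 4)" by (intro mult_left_mono exp_ge_add_one_self) auto
        finally have y: "norm y \<le> 2 * exp ((norm y)\<^sup>2 / 4)" .
        have "\<bar>g y * (y \<bullet> D)\<bar> \<le> g y * (norm y * norm D)"
          unfolding abs_mult using c Cauchy_Schwarz_ineq2[of y D]
          by (intro mult_mono) (auto simp: g_def)
        also have "\<dots> \<le> g y * (2 * exp ((norm y)\<^sup>2 / 4) * norm D)"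
          using c y by (intro mult_left_mono mult_right_mono) (auto simp: g_def)
        also have "\<dots> = 2 * c * norm D * (exp (- (norm y)\<^sup>2 / 2) * exp ((norm y)\<^sup>2 / 4))"
          by (simp add: g_def)
        also have "exp (- (norm y)\<^sup>2 / 2) * exp ((norm y)\<^sup>2 / 4) = exp (- (1/4) * (norm y)\<^sup>2)"
          by (simp add: exp_add[symmetric])
        finally show "norm (g y * (y \<bullet> D)) \<le> norm (2 * c * norm D * exp (- (1/4) * (norm y)\<^sup>2))"
          using c by (simp add: abs_mult)
      qed
    qed (use gm in simp)
    have "(\<integral>y. g y * (y \<bullet> D) \<partial>lborel) = (\<integral>y. g y * (y \<bullet> D) \<partial>distr lborel borel uminus)"
      by (simp only: lborel_distr_minus)
    also have "\<dots> = (\<integral>y. g (- y) * (- y \<bullet> D) \<partial>lborel)"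
      by (rule integral_distr) (use gm in auto)
    also have "\<dots> = - (\<integral>y. g y * (y \<bullet> D) \<partial>lborel)"
      by (simp add: g_def)
    finally show "(\<integral>y. g y * (y \<bullet> D) \<partial>lborel) = 0" by simp
  qed
  show thesis
  proof (rule that[OF Z])
    fix T T0 :: 'a
    define D where "D = T0 - T"
    have "(\<integral>x. c * exp (- (norm (x - T0))\<^sup>2 / 2) *
        ln (c * exp (- (norm (x - T0))\<^sup>2 / 2) / (c * exp (- (norm (x - T))\<^sup>2 / 2))) \<partial>lborel)
      = (\<integral>x. g (x - T0) * ((x - T0) \<bullet> D + (norm D)\<^sup>2 / 2) \<partial>lborel)"
    proof (rule Bochner_Integration.integral_cong[OF refl])
      fix x
      have "ln (c * exp (- (norm (x - T0))\<^sup>2 / 2) / (c * exp (- (norm (x - T))\<^sup>2 / 2)))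
          = - (norm (x - T0))\<^sup>2 / 2 - - (norm (x - T))\<^sup>2 / 2"
        using c by (simp add: exp_diff[symmetric])
      also have "\<dots> = (x - T0) \<bullet> D + (norm D)\<^sup>2 / 2"
      proof -
        have "(norm ((x - T0) + D))\<^sup>2 = (norm (x - T0))\<^sup>2 + 2 * ((x - T0) \<bullet> D) + (norm D)\<^sup>2"
          unfolding power2_norm_eq_inner by (simp add: inner_add_left inner_add_right inner_commute)
        moreover have "(x - T0) + D = x - T" by (simp add: D_def)
        ultimately have "(norm (x - T))\<^sup>2 = (norm (x - T0))\<^sup>2 + 2 * ((x - T0) \<bullet> D) + (norm D)\<^sup>2"
          by (simp only:)
        then show ?thesis by (simp add: field_simps)
      qed
      finally show "c * exp (- (norm (x - T0))\<^sup>2 / 2) *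
          ln (c * exp (- (norm (x - T0))\<^sup>2 / 2) / (c * exp (- (norm (x - T))\<^sup>2 / 2)))
        = g (x - T0) * ((x - T0) \<bullet> D + (norm D)\<^sup>2 / 2)" by (simp add: g_def)
    qed
    also have "\<dots> = (\<integral>x. g (x - T0) * ((x - T0) \<bullet> D + (norm D)\<^sup>2 / 2) \<partial>distr lborel borel ((+) T0))"
      by (simp only: lborel_distr_plus)
    also have "\<dots> = (\<integral>y. g (T0 + y - T0) * ((T0 + y - T0) \<bullet> D + (norm D)\<^sup>2 / 2) \<partial>lborel)"
      unfolding g_def
      by (intro integral_distr borel_measurable_continuous_onI continuous_intros) auto
    also have "\<dots> = (\<integral>y. g y * (y \<bullet> D) + g y * ((norm D)\<^sup>2 / 2) \<partial>lborel)"
      by (simp add: distrib_left)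
    also have "\<dots> = (\<integral>y. g y * (y \<bullet> D) \<partial>lborel) + (\<integral>y. g y * ((norm D)\<^sup>2 / 2) \<partial>lborel)"
      by (intro Bochner_Integration.integral_add lin integrable_mult_left gint)
    also have "\<dots> = Z * (norm (T - T0))\<^sup>2"
      unfolding lin(2) by (simp add: Z_def D_def norm_minus_commute)
    finally show "(\<integral>x. c * exp (- (norm (x - T0))\<^sup>2 / 2) *
        ln (c * exp (- (norm (x - T0))\<^sup>2 / 2) / (c * exp (- (norm (x - T))\<^sup>2 / 2))) \<partial>lborel)
      = Z * (norm (T - T0))\<^sup>2" .
  qed
qed

lemma frob2_eq_norm: "frob2 x = (norm x)\<^sup>2"
  unfolding frob2_def power2_norm_eq_inner inner_vec_def by (simp add: power2_eq_square)

lemma KL_tensor_eq: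
  fixes w0 :: "(real^'h::finite^'i::finite) \<times> (real^'h^'j::finite) \<times> (real^'h^'k::finite)"
  obtains Z where "0 < Z" "\<And>w. KL_tensor w0 w = Z * frob2 (cp_tensor (fst w) (fst (snd w)) (snd (snd w))
    - cp_tensor (fst w0) (fst (snd w0)) (snd (snd w0)))"
proof -
  have "0 < 1 / (2 * pi) powr (real (CARD('i) * CARD('j) * CARD('k)) / 2)" by simp
  then obtain Z where "0 < Z" and Z: "\<And>T T0 :: real^'k^'j^'i.
    (\<integral>x. 1 / (2 * pi) powr (real (CARD('i) * CARD('j) * CARD('k)) / 2) * exp (- (norm (x - T0))\<^sup>2 / 2) *
      ln (1 / (2 * pi) powr (real (CARD('i) * CARD('j) * CARD('k)) / 2) * exp (- (norm (x - T0))\<^sup>2 / 2)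
        / (1 / (2 * pi) powr (real (CARD('i) * CARD('j) * CARD('k)) / 2) * exp (- (norm (x - T))\<^sup>2 / 2))) \<partial>lborel)
    = Z * (norm (T - T0))\<^sup>2"
    by (rule gaussian_KL[where 'a = "real^'k^'j^'i"]) blast
  show thesis
    by (rule that[OF \<open>0 < Z\<close>]) (unfold KL_tensor_def tensor_density_def frob2_eq_norm, rule Z)
qed

theorem mainTheorem1:
  fixes A0 :: "real^'h^'i" and B0 :: "real^'h^'j" and C0 :: "real^'h^'k"
    and S :: "'h set" and H0 :: nat
    and \<phi> \<psi> :: "((real^'h^'i) \<times> (real^'h^'j) \<times> (real^'h^'k)) \<Rightarrow> real"
    and lam :: real
  assumes H0_def: "card S = H0" and H0_pos: "H0 \<ge> 1"
    and pad: "\<forall>h. h \<notin> S \<longrightarrow> (\<forall>i. A0$i$h = 0) \<and> (\<forall>j. B0$j$h = 0) \<and> (\<forall>k. C0$k$h = 0)"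
    and phi_meas: "\<phi> \<in> borel_measurable lborel"
    and phi_bound: "\<forall>w. 0 \<le> \<phi> w \<and> \<phi> w \<le> \<psi> w"
    and psi_smooth: "smooth_fun \<psi>"
    and psi_supp: "compact (tsupport \<psi>)" "(A0, B0, C0) \<in> tsupport \<psi>"
    and phi_pos: "\<exists>e>0. \<exists>c>0. \<forall>w\<in>ball (A0, B0, C0) e. \<phi> w \<ge> c"
    and rlct: "is_rlct (KL_tensor (A0, B0, C0)) \<phi> lam"
  shows "lam \<le> (real (H0 * (CARD('i) + CARD('j) + CARD('k))) - 2) / 2
           + Min {Ffun (CARD('i) * CARD('j)) CARD('k) (CARD('h) - H0),
                  Ffun (CARD('j) * CARD('k)) CARD('i) (CARD('h) - H0),
                  Ffun (CARD('k) * CARD('i)) CARD('j) (CARD('h) - H0)}"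
proof -
  let ?w0 = "(A0, B0, C0)"
  \<comment> \<open>The matrix units of the three blocks, as standard basis vectors of the product
    space.\<close>
  define eA :: "'i \<Rightarrow> 'h \<Rightarrow> (real^'h^'i) \<times> (real^'h^'j) \<times> (real^'h^'k)" where "eA i h = (axis i (axis h 1), 0, 0)" for i h
  define eB :: "'j \<Rightarrow> 'h \<Rightarrow> (real^'h^'i) \<times> (real^'h^'j) \<times> (real^'h^'k)" where "eB j h = (0, axis j (axis h 1), 0)" for j h
  define eC :: "'k \<Rightarrow> 'h \<Rightarrow> (real^'h^'i) \<times> (real^'h^'j) \<times> (real^'h^'k)" where "eC k h = (0, 0, axis k (axis h 1))" for k h
  have Bas: "eA i h \<in> Basis" "eB j h \<in> Basis" "eC k h \<in> Basis" for i j k h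
    by (auto simp: eA_def eB_def eC_def Basis_prod_def image_iff zero_prod_def)
  have nz: "axis a (axis b (1::real)) \<noteq> 0" for a b by (simp add: axis_eq_0_iff)
  have inj: "eA i h = eA i' h' \<Longrightarrow> i = i' \<and> h = h'" "eB j h = eB j' h' \<Longrightarrow> j = j' \<and> h = h'"
    "eC k h = eC k' h' \<Longrightarrow> k = k' \<and> h = h'" for i j k h i' j' k' h'
    by (auto simp: eA_def eB_def eC_def axis_eq_axis)
  have disj: "eA i h \<noteq> eB j h'" "eA i h \<noteq> eC k h'" "eB j h \<noteq> eC k h'"
    "eB j h \<noteq> eA i h'" "eC k h \<noteq> eA i h'" "eC k h \<noteq> eB j h'" for i j k h h'
    by (auto simp: eA_def eB_def eC_def nz)
  have coord: "w \<bullet> eA i h = fst w $ i $ h" "w \<bullet> eB j h = fst (snd w) $ j $ h" "w \<bullet> eC k h = snd (snd w) $ k $ h" for w i j k h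
    by (cases w; simp add: eA_def eB_def eC_def inner_axis)+
  have pads: "h \<notin> S \<Longrightarrow> ?w0 \<bullet> eA i h = 0" "h \<notin> S \<Longrightarrow> ?w0 \<bullet> eB j h = 0" "h \<notin> S \<Longrightarrow> ?w0 \<bullet> eC k h = 0" for i j k h
    using pad by (simp_all add: coord)
  have S: "S \<noteq> {}" using H0_def H0_pos by auto
  obtain Z where Z: "0 < Z" and KL: "\<And>w. KL_tensor ?w0 w = Z * frob2 (cp_tensor (fst w) (fst (snd w)) (snd (snd w)) - cp_tensor A0 B0 C0)"
    by (rule KL_tensor_eq[of ?w0]) simp
  define t where "t w i j k = tensor_entry eA eB eC w i j k" for w i j k
  \<comment> \<open>Reading the factors in a cyclic order changes the order of the indices but not
    the value of the entry.\<close>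
  have tB: "tensor_entry eB eC eA w j k i = t w i j k" and tC: "tensor_entry eC eA eB w k i j = t w i j k" for w i j k
    by (simp_all add: t_def tensor_entry_def mult_ac)
  have KA: "KL_tensor ?w0 w = Z * (\<Sum>i\<in>UNIV. \<Sum>j\<in>UNIV. \<Sum>k\<in>UNIV. (t w i j k - t ?w0 i j k)\<^sup>2)" for w
    by (simp add: KL frob2_def cp_tensor_def t_def tensor_entry_def coord)
  have KB: "KL_tensor ?w0 w = Z * (\<Sum>j\<in>UNIV. \<Sum>k\<in>UNIV. \<Sum>i\<in>UNIV. (t w i j k - t ?w0 i j k)\<^sup>2)" for w
    unfolding KA by (subst sum.swap, intro arg_cong[of _ _ "\<lambda>x. Z * x"] sum.cong refl, rule sum.swap)
  have KC: "KL_tensor ?w0 w = Z * (\<Sum>k\<in>UNIV. \<Sum>i\<in>UNIV. \<Sum>j\<in>UNIV. (t w i j k - t ?w0 i j k)\<^sup>2)" for w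
    unfolding KB by (subst sum.swap, intro arg_cong[of _ _ "\<lambda>x. Z * x"] sum.cong refl, rule sum.swap)
  have phim: "\<phi> \<in> borel_measurable borel" using phi_meas by simp
  have phi0: "0 \<le> \<phi> w" for w using phi_bound by blast
  have insupp: "w \<in> tsupport \<psi>" if "\<psi> w \<noteq> 0" for w
    using that closure_subset[of "{x. \<psi> x \<noteq> 0}"] by (auto simp: tsupport_def)
  have "bounded (tsupport \<psi>)" using psi_supp(1) by (rule compact_imp_bounded)
  then obtain R where R: "\<And>w. w \<in> tsupport \<psi> \<Longrightarrow> norm w < R"
    by (meson bounded_pos_less)
  have suppR: "norm w < R" if "\<phi> w \<noteq> 0" for w
  proof -
    have "\<psi> w \<noteq> 0" using that phi_bound by (metis order_antisym)
    then show ?thesis by (intro R insupp)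
  qed
  have "Ck_fun 0 \<psi>" using psi_smooth by (simp only: smooth_fun_def)
  then have "compact (\<psi> ` tsupport \<psi>)"
    by (intro compact_continuous_image psi_supp(1)) (auto intro: continuous_on_subset)
  then have "bounded (\<psi> ` tsupport \<psi>)" by (rule compact_imp_bounded)
  then obtain B where B: "0 < B" "\<And>w. w \<in> tsupport \<psi> \<Longrightarrow> \<bar>\<psi> w\<bar> \<le> B"
    by (auto simp: bounded_pos)
  have phiB: "\<phi> w \<le> B" for w
  proof (cases "\<psi> w = 0")
    case True
    then show ?thesis using phi_bound B(1) by (metis less_imp_le order_trans)
  next
    case False
    then show ?thesis using phi_bound B(2)[OF insupp[OF False]] by (meson abs_le_D1 order_trans)
  qed
  obtain e c where ec: "0 < e" "0 < c" "\<And>w. w \<in> ball ?w0 e \<Longrightarrow> c \<le> \<phi> w" using phi_pos by blast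
  have cS: "card (- S) = CARD('h) - H0"
    using H0_def by (simp add: Compl_eq_Diff_UNIV card_Diff_subset)
  \<comment> \<open>Three instances with \<open>C\<close>, then \<open>A\<close>, then
    \<open>B\<close> in third position; they share the point, the prior and the divergence, and
    differ in the order of summation and the names of the factors.\<close>
  have "lam \<le> (real (card S * (CARD('i) + CARD('j) + CARD('k))) - 2) / 2
      + Ffun (CARD('i) * CARD('j)) CARD('k) (card (- S))"
    by (rule rlct_le_codim[OF Bas inj(2,3) disj(1,2,3) pads S KA[unfolded t_def] Z phim phi0 phiB suppR ec rlct])
  moreover have "lam \<le> (real (card S * (CARD('j) + CARD('k) + CARD('i))) - 2) / 2
      + Ffun (CARD('j) * CARD('k)) CARD('i) (card (- S))"
    by (rule rlct_le_codim[OF Bas(2,3,1) inj(3,1) disj(3,4,5) pads(2,3,1) S KB[folded tB] Z phim phi0 phiB suppR ec rlct])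
  moreover have "lam \<le> (real (card S * (CARD('k) + CARD('i) + CARD('j))) - 2) / 2
      + Ffun (CARD('k) * CARD('i)) CARD('j) (card (- S))"
    by (rule rlct_le_codim[OF Bas(3,1,2) inj(1,2) disj(5,6,1) pads(3,1,2) S KC[folded tC] Z phim phi0 phiB suppR ec rlct])
  ultimately show ?thesis
    unfolding cS H0_def by (simp add: min_def add_ac)
qed

end
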